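(* Let $G$ be a linearly ordered abelian group (written additively), $F$ an algebraically closed field of characteristic $0$, and let $R=M_4(F)$ carry a $G$-grading whose neutral component is commutative. Then the $T_G$-ideal $T_G(R)$ of graded identities of $R$ is generated, as a $T_G$-ideal, by the identities (i) $x_1x_2-x_2x_1$ with $\deg x_1=\deg x_2=0$; (ii) $x_1x_2x_3-x_3x_2x_1$ with $\deg x_1=-\deg x_2=\deg x_3\neq 0$; (iii) $x_1$ with $R_{\deg x_1}=0$; if and only if there exist $a,b\in G$ with $a,b>0$, $a\neq 2b$ and $2a\neq b$, such that the grading on $R$ is isomorphic to the elementary grading on $M_4(F)$ induced by $(0,a,a+b,2a+b)$.
   Context: A linearly ordered group is a group with a translation-invariant total order. The elementary grading on $M_n(F)$ induced by $(g_1,\dots,g_n)$ is $R_g=\mathrm{span}\{e_{pq}: g_q-g_p=g\}$. Graded polynomials are elements of the free associative algebra on variables each having a prescribed degree in $G$; $T_G(R)$ is the set of graded polynomials vanishing under every substitution of each variable $x$ by an element of $R_{\deg x}$. A $T_G$-ideal is an ideal of the free $G$-graded algebra invariant under all degree-preserving endomorphisms, and a set generates a $T_G$-ideal if the latter is the smallest $T_G$-ideal containing it. Two $G$-gradings are isomorphic if there is an algebra isomorphism $\varphi$ with $\varphi(A_g)=B_g$ for all $g$. *)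

theory Defs
  imports "HOL-Analysis.Analysis" "HOL-Computational_Algebra.Polynomial"
begin

definition alg_closed :: "'f::field itself \<Rightarrow> bool" where
  "alg_closed _ \<longleftrightarrow> (\<forall>p::'f poly. 0 < degree p \<longrightarrow> (\<exists>x. poly p x = 0))"

text \<open>Variables: countably many of each degree; the variable (n, g) has degree g.
  A graded polynomial is a finitely supported function from words to F.\<close>

type_synonym 'g gvar = "nat \<times> 'g"
type_synonym ('f, 'g) fpoly = "'g gvar list \<Rightarrow> 'f"

definition fa_polys :: "('f::zero, 'g) fpoly set" where
  "fa_polys = {p. finite {w. p w \<noteq> 0}}"

definition fa_word :: "'g gvar list \<Rightarrow> ('f::{zero,one}, 'g) fpoly" where
  "fa_word w = (\<lambda>u. if u = w then 1 else 0)"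

definition fa_mult :: "('f::comm_ring_1, 'g) fpoly \<Rightarrow> ('f, 'g) fpoly \<Rightarrow> ('f, 'g) fpoly" where
  "fa_mult p q = (\<lambda>u. \<Sum>i\<le>length u. p (take i u) * q (drop i u))"

definition fa_prod :: "('f::comm_ring_1, 'g) fpoly list \<Rightarrow> ('f, 'g) fpoly" where
  "fa_prod ps = foldr fa_mult ps (fa_word [])"

definition wdeg :: "'g::monoid_add gvar list \<Rightarrow> 'g" where
  "wdeg w = sum_list (map snd w)"

definition fa_homog :: "'g::monoid_add \<Rightarrow> ('f::zero, 'g) fpoly set" where
  "fa_homog g = {p \<in> fa_polys. \<forall>w. p w \<noteq> 0 \<longrightarrow> wdeg w = g}"

definition fa_subst :: "('g gvar \<Rightarrow> ('f::comm_ring_1, 'g) fpoly) \<Rightarrow> ('f, 'g) fpoly \<Rightarrow> ('f, 'g) fpoly" where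
  "fa_subst \<tau> p = (\<lambda>u. \<Sum>w\<in>{w. p w \<noteq> 0}. p w * fa_prod (map \<tau> w) u)"

definition graded_endo :: "('g::monoid_add gvar \<Rightarrow> ('f::comm_ring_1, 'g) fpoly) \<Rightarrow> bool" where
  "graded_endo \<tau> \<longleftrightarrow> (\<forall>x. \<tau> x \<in> fa_homog (snd x))"

definition TG_ideal :: "('f::comm_ring_1, 'g::monoid_add) fpoly set \<Rightarrow> bool" where
  "TG_ideal I \<longleftrightarrow> I \<subseteq> fa_polys \<and> (\<lambda>u. 0) \<in> I \<and> (\<forall>p\<in>I. \<forall>q\<in>I. (\<lambda>u. p u + q u) \<in> I)
     \<and> (\<forall>p\<in>I. \<forall>f\<in>fa_polys. fa_mult f p \<in> I \<and> fa_mult p f \<in> I)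
     \<and> (\<forall>p\<in>I. \<forall>\<tau>. graded_endo \<tau> \<longrightarrow> fa_subst \<tau> p \<in> I)"

definition TG_generated :: "('f::comm_ring_1, 'g::monoid_add) fpoly set \<Rightarrow> ('f, 'g) fpoly set" where
  "TG_generated S = \<Inter>{I. TG_ideal I \<and> S \<subseteq> I}"

definition msmult :: "'f::times \<Rightarrow> 'f^'n^'m \<Rightarrow> 'f^'n^'m" where
  "msmult c M = (\<chi> i j. c * M $ i $ j)"

definition mat_subspace :: "('f::field^'n^'n) set \<Rightarrow> bool" where
  "mat_subspace V \<longleftrightarrow> 0 \<in> V \<and> (\<forall>x\<in>V. \<forall>y\<in>V. x + y \<in> V) \<and> (\<forall>c. \<forall>x\<in>V. msmult c x \<in> V)"

definition is_grading :: "('g::comm_monoid_add \<Rightarrow> ('f::field^'n::finite^'n) set) \<Rightarrow> bool" where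
  "is_grading A \<longleftrightarrow>
     (\<forall>g. mat_subspace (A g))
   \<and> (\<forall>g h. \<forall>x\<in>A g. \<forall>y\<in>A h. x ** y \<in> A (g + h))
   \<and> (\<forall>M. \<exists>c. finite {g. c g \<noteq> 0} \<and> (\<forall>g. c g \<in> A g) \<and> M = sum c {g. c g \<noteq> 0})
   \<and> (\<forall>c. finite {g. c g \<noteq> 0} \<and> (\<forall>g. c g \<in> A g) \<and> sum c {g. c g \<noteq> 0} = 0
          \<longrightarrow> (\<forall>g. c g = 0))"

definition alg_iso :: "('f::field^'n::finite^'n \<Rightarrow> 'f^'n^'n) \<Rightarrow> bool" where
  "alg_iso \<phi> \<longleftrightarrow> bij \<phi> \<and> (\<forall>x y. \<phi> (x + y) = \<phi> x + \<phi> y)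
     \<and> (\<forall>c x. \<phi> (msmult c x) = msmult c (\<phi> x)) \<and> (\<forall>x y. \<phi> (x ** y) = \<phi> x ** \<phi> y)"

definition iso_gradings :: "('g \<Rightarrow> ('f::field^'n::finite^'n) set) \<Rightarrow> ('g \<Rightarrow> ('f^'n^'n) set) \<Rightarrow> bool" where
  "iso_gradings A B \<longleftrightarrow> (\<exists>\<phi>. alg_iso \<phi> \<and> (\<forall>g. \<phi> ` A g = B g))"

definition elementary_grading :: "('n \<Rightarrow> 'g::ab_group_add) \<Rightarrow> 'g \<Rightarrow> ('f::zero^'n^'n) set" where
  "elementary_grading d g = {M. \<forall>p q. M $ p $ q \<noteq> 0 \<longrightarrow> d q - d p = g}"

definition eval_word :: "('g gvar \<Rightarrow> 'f::comm_ring_1^'n::finite^'n) \<Rightarrow> 'g gvar list \<Rightarrow> 'f^'n^'n" where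
  "eval_word \<sigma> w = foldr (\<lambda>x M. \<sigma> x ** M) w (mat 1)"

definition eval_fa :: "('g gvar \<Rightarrow> 'f::comm_ring_1^'n::finite^'n) \<Rightarrow> ('f, 'g) fpoly \<Rightarrow> 'f^'n^'n" where
  "eval_fa \<sigma> p = (\<Sum>w\<in>{w. p w \<noteq> 0}. msmult (p w) (eval_word \<sigma> w))"

definition graded_identities :: "('g \<Rightarrow> ('f::comm_ring_1^'n::finite^'n) set) \<Rightarrow> ('f, 'g) fpoly set" where
  "graded_identities A = {p \<in> fa_polys. \<forall>\<sigma>. (\<forall>x. \<sigma> x \<in> A (snd x)) \<longrightarrow> eval_fa \<sigma> p = 0}"

definition gen_identities :: "('g::ab_group_add \<Rightarrow> ('f::comm_ring_1^'n::finite^'n) set) \<Rightarrow> ('f, 'g) fpoly set" where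
  "gen_identities A =
     {(\<lambda>u. fa_word [(1,0),(2,0)] u - fa_word [(2,0),(1,0)] u)}
   \<union> {(\<lambda>u. fa_word [(1,g),(2,-g),(3,g)] u - fa_word [(3,g),(2,-g),(1,g)] u) | g. g \<noteq> 0}
   \<union> {fa_word [(1,g)] | g. A g = {0}}"

end

(* Walks. Evaluating a word at generic homogeneous elements of an elementary grading, the row that
   belongs to g_p records the walk that starts at g_p and has the degrees of the letters as steps,
   through the multiset of its labelled steps.  Two words with the same multiset are Eulerian trails
   of the same graph and differ by the moves (i) and (ii).  Hence, modulo (i)-(iii), only the words
   that label no walk at all matter, and these are consequences of (iii) iff every finite set of
   degrees with all differences in the support can be translated into {g_1,...,g_4}.  For gaps
   (x,y,z) this is tested by -{g_1,...,g_4}, which forces x = z, and by {0,y,2y,3y} and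
   {0,x,2x,3x}, which exclude x = 2y and y = 2x.

   A grading of a matrix algebra by an ordered group is elementary: a homogeneous element with maximal
   kernel leads to a homogeneous idempotent e of degree 0 with eMe in Fe for all M, and the
   subspaces A_g u with u in the image of e grade the column space. *)

theory Submission
  imports Defs "HOL-Library.Multiset" "HOL-Computational_Algebra.Primes"
begin

section \<open>Evaluation of graded polynomials\<close>

text \<open>Commutativity of the neutral component says that g_1,...,g_4 are distinct. A row of a
  homogeneous matrix then has at most one nonzero entry, so every entry of an evaluated word is one
  monomial or 0, and in characteristic 0 a vanishing polynomial function has vanishing coefficients.
  The translation criterion comes from the prefixes of a word: differences of their degrees are, up
  to sign, degrees of factors, and a factor of degree outside the support is a consequence of (iii).
  Necessity rests on the fact that (i)-(iii) see the grading only through its support. Another tuple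
  of distinct degrees with all differences in the support satisfies (i)-(iii), hence all identities
  of R if these generate. The negated tuple has the same support. For x = z = 2y the tuple is
  (0,2,3,5) times y, for x = z and y = 2x it is (0,1,3,4) times x; both have the differences 1, 2, 3
  but contain no three consecutive multiples. The order on G serves to sort the tuple and, for
  arbitrary gradings, to make the multiples of a nonzero degree distinct, so that homogeneous
  elements of nonzero degree are nilpotent.\<close>

lemma msmult_component [simp]: "msmult c M $ i $ j = c * M $ i $ j"
  by (simp add: msmult_def)

lemma msmult_zero [simp]: "msmult (0::'f::comm_ring_1) M = 0"
  by (simp add: vec_eq_iff)

lemma msmult_one [simp]: "msmult (1::'f::comm_ring_1) M = M"
  by (simp add: vec_eq_iff)

lemma msmult_add_left: "msmult (c + d :: 'f::comm_ring_1) M = msmult c M + msmult d M"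
  by (simp add: vec_eq_iff algebra_simps)

lemma msmult_msmult: "msmult (c :: 'f::comm_ring_1) (msmult d M) = msmult (c * d) M"
  by (simp add: vec_eq_iff algebra_simps)

lemma msmult_sum_left: "msmult (sum f S :: 'f::comm_ring_1) M = (\<Sum>x\<in>S. msmult (f x) M)"
  by (simp add: vec_eq_iff sum_distrib_right)

lemma msmult_sum_right: "msmult (c :: 'f::comm_ring_1) (sum f S) = (\<Sum>x\<in>S. msmult c (f x))"
  by (simp add: vec_eq_iff sum_distrib_left)

lemma msmult_mult:
  fixes M :: "'f::comm_ring_1^'n::finite^'m" and N :: "'f^'k^'n"
  shows "msmult (c * d) (M ** N) = msmult c M ** msmult d N"
  by (simp add: vec_eq_iff matrix_matrix_mult_def sum_distrib_left algebra_simps)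

lemma matrix_mult_sum_left:
  fixes f :: "'b \<Rightarrow> 'f::comm_ring_1^'n::finite^'m" and N :: "'f^'k^'n"
  shows "sum f S ** N = (\<Sum>x\<in>S. f x ** N)"
  by (simp add: vec_eq_iff matrix_matrix_mult_def sum_distrib_right) (intro allI, rule sum.swap)

lemma matrix_mult_sum_right:
  fixes f :: "'b \<Rightarrow> 'f::comm_ring_1^'n::finite^'m::finite" and N :: "'f^'m^'k"
  shows "N ** sum f S = (\<Sum>x\<in>S. N ** f x)"
  by (simp add: vec_eq_iff matrix_matrix_mult_def sum_distrib_left) (intro allI, rule sum.swap)

lemma eval_word_Nil [simp]: "eval_word \<sigma> [] = mat 1"
  by (simp add: eval_word_def)

lemma eval_word_Cons [simp]: "eval_word \<sigma> (x # w) = \<sigma> x ** eval_word \<sigma> w"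
  by (simp add: eval_word_def)

lemma eval_word_append: "eval_word \<sigma> (v @ w) = eval_word \<sigma> v ** eval_word \<sigma> w"
  by (induction v) (simp_all add: matrix_mul_assoc)

lemma eval_fa_superset:
  assumes "finite W" "{w. p w \<noteq> 0} \<subseteq> W"
  shows "eval_fa \<sigma> p = (\<Sum>w\<in>W. msmult (p w) (eval_word \<sigma> w))"
  unfolding eval_fa_def using assms by (intro sum.mono_neutral_left) auto

lemma eval_fa_zero [simp]: "eval_fa \<sigma> (\<lambda>u. 0) = 0"
  by (simp add: eval_fa_def)

lemma eval_fa_add:
  assumes "p \<in> fa_polys" "q \<in> fa_polys"
  shows "eval_fa \<sigma> (\<lambda>u. p u + q u) = eval_fa \<sigma> p + eval_fa \<sigma> q"
proof -
  let ?W = "{w. p w \<noteq> 0} \<union> {w. q w \<noteq> 0}"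
  have fin: "finite ?W" using assms by (simp add: fa_polys_def)
  have "eval_fa \<sigma> (\<lambda>u. p u + q u) = (\<Sum>w\<in>?W. msmult (p w + q w) (eval_word \<sigma> w))"
    using fin by (intro eval_fa_superset) auto
  also have "\<dots> = (\<Sum>w\<in>?W. msmult (p w) (eval_word \<sigma> w)) + (\<Sum>w\<in>?W. msmult (q w) (eval_word \<sigma> w))"
    by (simp add: msmult_add_left sum.distrib)
  also have "\<dots> = eval_fa \<sigma> p + eval_fa \<sigma> q"
    using fin by (simp add: eval_fa_superset[of ?W])
  finally show ?thesis .
qed

lemma eval_fa_scale: "eval_fa \<sigma> (\<lambda>u. c * p u) = msmult c (eval_fa \<sigma> p)"
  if "p \<in> fa_polys"
proof -
  have "eval_fa \<sigma> (\<lambda>u. c * p u) = (\<Sum>w\<in>{w. p w \<noteq> 0}. msmult (c * p w) (eval_word \<sigma> w))"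
    using that by (intro eval_fa_superset) (auto simp: fa_polys_def)
  then show ?thesis by (simp add: eval_fa_def msmult_sum_right msmult_msmult)
qed

lemma fa_polys_zero [simp]: "(\<lambda>u. 0) \<in> fa_polys"
  by (simp add: fa_polys_def)

lemma fa_polys_add: "(\<lambda>u. p u + q u) \<in> fa_polys"
  if "p \<in> fa_polys" "q \<in> fa_polys" for p q :: "('f::comm_ring_1, 'g) fpoly"
proof -
  have "finite ({w. p w \<noteq> 0} \<union> {w. q w \<noteq> 0})" using that by (simp add: fa_polys_def)
  moreover have "{w. p w + q w \<noteq> 0} \<subseteq> {w. p w \<noteq> 0} \<union> {w. q w \<noteq> 0}" by auto
  ultimately show ?thesis unfolding fa_polys_def by (blast intro: finite_subset)
qed

lemma fa_polys_scale: "(\<lambda>u. c * p u) \<in> fa_polys"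
  if "p \<in> fa_polys" for p :: "('f::comm_ring_1, 'g) fpoly"
  using that unfolding fa_polys_def by (auto elim!: finite_subset[rotated])

lemma fa_polys_sum: "(\<lambda>u. \<Sum>x\<in>S. f x u) \<in> fa_polys"
  if "\<And>x. x \<in> S \<Longrightarrow> f x \<in> fa_polys" for f :: "'b \<Rightarrow> ('f::comm_ring_1, 'g) fpoly"
  using that by (induction S rule: infinite_finite_induct) (auto intro: fa_polys_add)

lemma eval_fa_sum: "eval_fa \<sigma> (\<lambda>u. \<Sum>x\<in>S. f x u) = (\<Sum>x\<in>S. eval_fa \<sigma> (f x))"
  if "\<And>x. x \<in> S \<Longrightarrow> f x \<in> fa_polys" for f :: "'b \<Rightarrow> ('f::comm_ring_1, 'g) fpoly"
  using that
proof (induction S rule: infinite_finite_induct)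
  case (insert x S)
  have "(\<lambda>u. \<Sum>x\<in>S. f x u) \<in> fa_polys" using insert.prems by (intro fa_polys_sum) auto
  then show ?case using insert by (simp add: eval_fa_add)
qed simp_all

lemma fa_polys_word [simp]: "(fa_word w :: ('f::comm_ring_1, 'g) fpoly) \<in> fa_polys"
proof -
  have "{u. (fa_word w u :: 'f) \<noteq> 0} \<subseteq> {w}" by (auto simp: fa_word_def)
  then show ?thesis unfolding fa_polys_def by (blast intro: finite_subset)
qed

lemma eval_fa_word [simp]: "eval_fa \<sigma> (fa_word w) = eval_word \<sigma> w"
proof -
  have "eval_fa \<sigma> (fa_word w) = (\<Sum>u\<in>{w}. msmult (fa_word w u) (eval_word \<sigma> u))"
    by (intro eval_fa_superset) (auto simp: fa_word_def)
  then show ?thesis by (simp add: fa_word_def)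
qed

text \<open>Cut positions of \<open>u\<close> correspond to factorizations of \<open>u\<close> into
  two words. Summing over pairs from a fixed finite box, instead of over positions that depend on
  \<open>u\<close>, permits the exchange of sums in \<open>eval_fa_mult\<close>.\<close>

lemma fa_mult_conv_sum:
  fixes p q :: "('f::comm_ring_1, 'g) fpoly"
  assumes P: "finite P" "{w. p w \<noteq> 0} \<subseteq> P" and Q: "finite Q" "{w. q w \<noteq> 0} \<subseteq> Q"
  shows "fa_mult p q u = (\<Sum>z\<in>P\<times>Q. if fst z @ snd z = u then p (fst z) * q (snd z) else 0)"
proof -
  let ?f = "\<lambda>i. (take i u, drop i u)"
  have inj: "inj_on ?f {..length u}"
    by (rule inj_onI) (metis atMost_iff length_take min.absorb2 prod.inject)
  have im: "?f ` {..length u} = {z. fst z @ snd z = u}"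
  proof (intro equalityI subsetI)
    fix z assume "z \<in> {z. fst z @ snd z = u}"
    then have "z = ?f (length (fst z))" "length (fst z) \<le> length u" by (auto simp: prod_eq_iff)
    then show "z \<in> ?f ` {..length u}" by blast
  qed auto
  have fin: "finite {z. fst z @ snd z = u}" unfolding im[symmetric] by simp
  have "fa_mult p q u = (\<Sum>z\<in>?f ` {..length u}. p (fst z) * q (snd z))"
    unfolding fa_mult_def by (subst sum.reindex[OF inj]) simp
  also have "\<dots> = (\<Sum>z\<in>{z. fst z @ snd z = u}. p (fst z) * q (snd z))"
    by (simp only: im)
  also have "\<dots> = (\<Sum>z\<in>{z\<in>P\<times>Q. fst z @ snd z = u}. p (fst z) * q (snd z))"
  proof (rule sum.mono_neutral_right[OF fin])
    show "\<forall>z\<in>{z. fst z @ snd z = u} - {z \<in> P \<times> Q. fst z @ snd z = u}. p (fst z) * q (snd z) = 0"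
    proof
      fix z assume "z \<in> {z. fst z @ snd z = u} - {z \<in> P \<times> Q. fst z @ snd z = u}"
      then have "fst z \<notin> P \<or> snd z \<notin> Q" by (auto simp: mem_Times_iff)
      then have "p (fst z) = 0 \<or> q (snd z) = 0" using P(2) Q(2) by blast
      then show "p (fst z) * q (snd z) = 0" by auto
    qed
  qed auto
  also have "\<dots> = (\<Sum>z\<in>P\<times>Q. if fst z @ snd z = u then p (fst z) * q (snd z) else 0)"
    using P Q by (simp add: sum.inter_filter)
  finally show ?thesis .
qed

lemma fa_mult_polys:
  fixes p q :: "('f::comm_ring_1, 'g) fpoly"
  assumes "p \<in> fa_polys" "q \<in> fa_polys"
  shows "fa_mult p q \<in> fa_polys"
proof -
  let ?P = "{w. p w \<noteq> 0}" and ?Q = "{w. q w \<noteq> 0}"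
  have fin: "finite ?P" "finite ?Q" using assms by (auto simp: fa_polys_def)
  have "{u. fa_mult p q u \<noteq> 0} \<subseteq> (\<lambda>z. fst z @ snd z) ` (?P \<times> ?Q)"
  proof
    fix u assume "u \<in> {u. fa_mult p q u \<noteq> 0}"
    then have "(\<Sum>z\<in>?P\<times>?Q. if fst z @ snd z = u then p (fst z) * q (snd z) else 0) \<noteq> 0"
      using fa_mult_conv_sum[of ?P p ?Q q u] fin by auto
    then obtain z where "z \<in> ?P\<times>?Q" "fst z @ snd z = u"
      by (rule sum.not_neutral_contains_not_neutral) (auto split: if_splits)
    then show "u \<in> (\<lambda>z. fst z @ snd z) ` (?P \<times> ?Q)" by blast
  qed
  then show ?thesis using fin unfolding fa_polys_def
    by (auto intro: finite_subset[OF _ finite_imageI[OF finite_cartesian_product]])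
qed

lemma eval_fa_mult:
  fixes p q :: "('f::comm_ring_1, 'g) fpoly"
  assumes "p \<in> fa_polys" "q \<in> fa_polys"
  shows "eval_fa \<sigma> (fa_mult p q) = eval_fa \<sigma> p ** eval_fa \<sigma> q"
proof -
  let ?P = "{w. p w \<noteq> 0}" and ?Q = "{w. q w \<noteq> 0}"
  let ?a = "\<lambda>z::'g gvar list \<times> 'g gvar list. fst z @ snd z"
  let ?U = "?a ` (?P \<times> ?Q)"
  have fin: "finite ?P" "finite ?Q" using assms by (auto simp: fa_polys_def)
  have conv: "fa_mult p q u = (\<Sum>z\<in>?P\<times>?Q. if ?a z = u then p (fst z) * q (snd z) else 0)" for u
    using fin by (intro fa_mult_conv_sum) auto
  have sub: "{u. fa_mult p q u \<noteq> 0} \<subseteq> ?U"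
  proof
    fix u assume "u \<in> {u. fa_mult p q u \<noteq> 0}"
    then have "(\<Sum>z\<in>?P\<times>?Q. if ?a z = u then p (fst z) * q (snd z) else 0) \<noteq> 0"
      using conv by auto
    then obtain z where "z \<in> ?P\<times>?Q" "?a z = u"
      by (rule sum.not_neutral_contains_not_neutral) (auto split: if_splits)
    then show "u \<in> ?U" by blast
  qed
  have finU: "finite ?U" using fin by blast
  have "eval_fa \<sigma> (fa_mult p q) = (\<Sum>u\<in>?U. msmult (fa_mult p q u) (eval_word \<sigma> u))"
    by (rule eval_fa_superset[OF finU sub])
  also have "\<dots> = (\<Sum>u\<in>?U. \<Sum>z\<in>?P\<times>?Q. if ?a z = u then msmult (p (fst z) * q (snd z)) (eval_word \<sigma> u) else 0)"
    unfolding conv msmult_sum_left by (intro sum.cong refl) auto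
  also have "\<dots> = (\<Sum>z\<in>?P\<times>?Q. \<Sum>u\<in>?U. if ?a z = u then msmult (p (fst z) * q (snd z)) (eval_word \<sigma> u) else 0)"
    by (rule sum.swap)
  also have "\<dots> = (\<Sum>z\<in>?P\<times>?Q. msmult (p (fst z) * q (snd z)) (eval_word \<sigma> (?a z)))"
    using finU by (intro sum.cong refl) (simp only: sum.delta', auto)
  also have "\<dots> = (\<Sum>z\<in>?P\<times>?Q. msmult (p (fst z)) (eval_word \<sigma> (fst z)) ** msmult (q (snd z)) (eval_word \<sigma> (snd z)))"
    by (simp add: eval_word_append msmult_mult)
  also have "\<dots> = eval_fa \<sigma> p ** eval_fa \<sigma> q"
    unfolding eval_fa_def matrix_mult_sum_left matrix_mult_sum_right
    by (subst sum.swap) (simp add: sum.cartesian_product split_beta)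
  finally show ?thesis .
qed

lemma fa_mult_word_word: "fa_mult (fa_word v) (fa_word w) = (fa_word (v @ w) :: ('f::comm_ring_1, 'g) fpoly)"
proof
  fix u
  have "fa_mult (fa_word v) (fa_word w) u
      = (\<Sum>z\<in>{v}\<times>{w}. if fst z @ snd z = u then fa_word v (fst z) * fa_word w (snd z) else (0::'f))"
    by (rule fa_mult_conv_sum) (auto simp: fa_word_def)
  then show "fa_mult (fa_word v) (fa_word w) u = (fa_word (v @ w) u :: 'f)"
    by (auto simp: fa_word_def)
qed

lemma fa_mult_diff_right: "fa_mult f (\<lambda>u. p u - q u) = (\<lambda>u. fa_mult f p u - fa_mult f q u)"
  for f p q :: "('f::comm_ring_1, 'g) fpoly"
  by (auto simp: fa_mult_def right_diff_distrib sum_subtractf)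

lemma fa_mult_diff_left: "fa_mult (\<lambda>u. p u - q u) f = (\<lambda>u. fa_mult p f u - fa_mult q f u)"
  for f p q :: "('f::comm_ring_1, 'g) fpoly"
  by (auto simp: fa_mult_def left_diff_distrib sum_subtractf)

lemma fa_mult_scalar: "fa_mult (\<lambda>u. c * fa_word [] u) p = (\<lambda>u. c * p u)"
  for p :: "('f::comm_ring_1, 'g) fpoly"
proof
  fix u
  have "fa_mult (\<lambda>u. c * fa_word [] u) p u = (\<Sum>i\<le>length u. if i = 0 then c * p u else 0)"
    unfolding fa_mult_def by (intro sum.cong refl) (auto simp: fa_word_def)
  then show "fa_mult (\<lambda>u. c * fa_word [] u) p u = c * p u" by simp
qed

lemma fa_prod_polys: "fa_prod ps \<in> fa_polys"
  if "\<And>p. p \<in> set ps \<Longrightarrow> p \<in> fa_polys" for ps :: "('f::comm_ring_1, 'g) fpoly list"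
  using that by (induction ps) (auto simp: fa_prod_def intro: fa_mult_polys)

lemma fa_prod_Cons [simp]: "fa_prod (p # ps) = fa_mult p (fa_prod ps)"
  by (simp add: fa_prod_def)

lemma fa_prod_Nil [simp]: "fa_prod [] = fa_word []"
  by (simp add: fa_prod_def)

lemma eval_fa_prod:
  fixes \<tau> :: "'g gvar \<Rightarrow> ('f::comm_ring_1, 'g) fpoly"
  assumes "\<And>x. \<tau> x \<in> fa_polys"
  shows "eval_fa \<sigma> (fa_prod (map \<tau> w)) = eval_word (\<lambda>x. eval_fa \<sigma> (\<tau> x)) w"
proof (induction w)
  case (Cons x w)
  have "fa_prod (map \<tau> w) \<in> fa_polys" using assms by (intro fa_prod_polys) auto
  with Cons assms show ?case by (simp add: eval_fa_mult)
qed simp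

lemma fa_subst_polys:
  fixes \<tau> :: "'g gvar \<Rightarrow> ('f::comm_ring_1, 'g) fpoly"
  assumes "\<And>x. \<tau> x \<in> fa_polys"
  shows "fa_subst \<tau> p \<in> fa_polys"
  unfolding fa_subst_def using assms
  by (intro fa_polys_sum fa_polys_scale fa_prod_polys) auto

lemma eval_fa_subst:
  fixes \<tau> :: "'g gvar \<Rightarrow> ('f::comm_ring_1, 'g) fpoly"
  assumes "\<And>x. \<tau> x \<in> fa_polys"
  shows "eval_fa \<sigma> (fa_subst \<tau> p) = eval_fa (\<lambda>x. eval_fa \<sigma> (\<tau> x)) p"
proof -
  have pol: "fa_prod (map \<tau> w) \<in> fa_polys" for w using assms by (intro fa_prod_polys) auto
  have "eval_fa \<sigma> (fa_subst \<tau> p) = (\<Sum>w\<in>{w. p w \<noteq> 0}. eval_fa \<sigma> (\<lambda>u. p w * fa_prod (map \<tau> w) u))"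
    unfolding fa_subst_def using pol by (intro eval_fa_sum fa_polys_scale) auto
  also have "\<dots> = eval_fa (\<lambda>x. eval_fa \<sigma> (\<tau> x)) p"
    unfolding eval_fa_def[of "\<lambda>x. eval_fa \<sigma> (\<tau> x)"]
    using pol assms by (simp add: eval_fa_scale eval_fa_prod)
  finally show ?thesis .
qed

lemma fa_subst_word_diff:
  fixes \<tau> :: "'g gvar \<Rightarrow> ('f::comm_ring_1, 'g) fpoly"
  assumes "v \<noteq> w"
  shows "fa_subst \<tau> (\<lambda>u. fa_word v u - fa_word w u)
    = (\<lambda>u. fa_prod (map \<tau> v) u - fa_prod (map \<tau> w) u)"
proof
  fix u
  have "{x. (fa_word v x - fa_word w x :: 'f) \<noteq> 0} = {v, w}" using assms by (auto simp: fa_word_def)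
  then show "fa_subst \<tau> (\<lambda>u. fa_word v u - fa_word w u) u
      = fa_prod (map \<tau> v) u - fa_prod (map \<tau> w) u"
    using assms by (simp add: fa_subst_def) (simp add: fa_word_def)
qed

lemma fa_subst_word: "fa_subst \<tau> (fa_word v) = fa_prod (map \<tau> v)"
  for \<tau> :: "'g gvar \<Rightarrow> ('f::comm_ring_1, 'g) fpoly"
proof
  fix u
  have "{x. (fa_word v x :: 'f) \<noteq> 0} = {v}" by (auto simp: fa_word_def)
  then show "fa_subst \<tau> (fa_word v) u = fa_prod (map \<tau> v) u"
    by (simp add: fa_subst_def) (simp add: fa_word_def)
qed

lemma wdeg_Nil [simp]: "wdeg [] = 0"
  by (simp add: wdeg_def)

lemma wdeg_Cons [simp]: "wdeg (x # w) = snd x + wdeg w"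
  by (simp add: wdeg_def)

lemma wdeg_append [simp]: "wdeg (v @ w) = wdeg v + wdeg (w :: 'g::monoid_add gvar list)"
  by (simp add: wdeg_def)

lemma fa_word_homog: "(fa_word w :: ('f::comm_ring_1, 'g::monoid_add) fpoly) \<in> fa_homog (wdeg w)"
proof -
  have "(fa_word w :: ('f, 'g) fpoly) \<in> fa_polys" by simp
  moreover have "fa_word w u \<noteq> (0::'f) \<Longrightarrow> wdeg u = wdeg w" for u
    by (simp add: fa_word_def split: if_splits)
  ultimately show ?thesis by (simp add: fa_homog_def)
qed

section \<open>Walks in elementary gradings\<close>

lemma eval_fa_diff:
  assumes "p \<in> fa_polys" "q \<in> fa_polys"
  shows "eval_fa \<sigma> (\<lambda>u. p u - q u) = eval_fa \<sigma> p - eval_fa \<sigma> q"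
proof -
  have "eval_fa \<sigma> (\<lambda>u. p u + (- 1) * q u) = eval_fa \<sigma> p + msmult (- 1) (eval_fa \<sigma> q)"
    using assms by (subst eval_fa_add) (auto simp only: fa_polys_scale eval_fa_scale)
  moreover have "msmult (- 1) (eval_fa \<sigma> q) = - eval_fa \<sigma> q" by (simp add: vec_eq_iff)
  ultimately show ?thesis by simp
qed

lemma fa_polys_diff: "(\<lambda>u. p u - q u) \<in> fa_polys"
  if "p \<in> fa_polys" "q \<in> fa_polys" for p q :: "('f::comm_ring_1, 'g) fpoly"
  using fa_polys_add[OF that(1) fa_polys_scale[OF that(2), of "- 1"]] by simp

text \<open>The pair \<open>(x, s)\<close> names the entry, in the row of degree \<open>s\<close>,
  of the matrix substituted for \<open>x\<close>. The multiset is thus the commutative monomial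
  contributed by a walk.\<close>

fun steps :: "'g::ab_group_add \<Rightarrow> 'g gvar list \<Rightarrow> ('g gvar \<times> 'g) multiset" where
  "steps s [] = {#}"
| "steps s (x # w) = add_mset (x, s) (steps (s + snd x) w)"

fun stays_in :: "'g::ab_group_add set \<Rightarrow> 'g \<Rightarrow> 'g gvar list \<Rightarrow> bool" where
  "stays_in D s [] \<longleftrightarrow> s \<in> D"
| "stays_in D s (x # w) \<longleftrightarrow> s \<in> D \<and> stays_in D (s + snd x) w"

lemma stays_in_start: "stays_in D s w \<Longrightarrow> s \<in> D"
  by (cases w) auto

lemma stays_in_end: "stays_in D s w \<Longrightarrow> s + wdeg w \<in> D"
  by (induction D s w rule: stays_in.induct) (auto simp: algebra_simps)

lemma steps_append: "steps s (v @ w) = steps s v + steps (s + wdeg v) w"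
  by (induction v arbitrary: s) (auto simp: algebra_simps)

text \<open>Injectivity of \<open>d\<close> leaves at most one nonzero entry in each row of
  \<open>\<sigma> x\<close>, so the sum over the inner index of every matrix product collapses to at
  most one term.\<close>

lemma eval_word_elementary_entry:
  fixes d :: "'n::finite \<Rightarrow> 'g::ab_group_add" and \<sigma> :: "'g gvar \<Rightarrow> 'f::comm_ring_1^'n^'n"
  assumes d: "inj d" and \<sigma>: "\<And>x. \<sigma> x \<in> elementary_grading d (snd x)"
  shows "eval_word \<sigma> w $ i $ j =
    (if stays_in (range d) (d i) w \<and> d j = d i + wdeg w
     then \<Prod>z\<in>#steps (d i) w. \<sigma> (fst z) $ inv d (snd z) $ inv d (snd z + snd (fst z)) else 0)"
proof (induction w arbitrary: i)
  case Nil
  show ?case using inj_eq[OF d] by (auto simp: mat_def)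
next
  case (Cons x w)
  let ?E = "eval_word \<sigma> w"
  have z: "d k = d i + snd x" if "\<sigma> x $ i $ k \<noteq> 0" for k
    using \<sigma>[of x] that unfolding elementary_grading_def by (auto simp: algebra_simps)
  have e: "eval_word \<sigma> (x # w) $ i $ j = (\<Sum>k\<in>UNIV. \<sigma> x $ i $ k * ?E $ k $ j)"
    by (simp add: matrix_matrix_mult_def)
  show ?case
  proof (cases "d i + snd x \<in> range d")
    case False
    then have "\<not> stays_in (range d) (d i + snd x) w" using stays_in_start by blast
    moreover have "\<sigma> x $ i $ k = 0" for k using z[of k] False by (metis rangeI)
    ultimately show ?thesis unfolding e by simp
  next
    case True
    then obtain k where k: "d k = d i + snd x" by (metis rangeE)
    have "\<sigma> x $ i $ l = 0" if "l \<noteq> k" for l using z[of l] k that inj_eq[OF d] by metis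
    then have "(\<Sum>l\<in>UNIV. \<sigma> x $ i $ l * ?E $ l $ j) = (\<Sum>l\<in>{k}. \<sigma> x $ i $ l * ?E $ l $ j)"
      by (intro sum.mono_neutral_right) auto
    moreover have "inv d (d i + snd x) = k" using k inv_f_f[OF d] by metis
    ultimately show ?thesis unfolding e using Cons[of k] inv_f_f[OF d]
      by (auto simp: k algebra_simps)
  qed
qed

lemma elementary_grading_mult:
  fixes d :: "'n::finite \<Rightarrow> 'g::ab_group_add" and M :: "'f::comm_ring_1^'n^'n"
  assumes "M \<in> elementary_grading d g" "N \<in> elementary_grading d h"
  shows "M ** N \<in> elementary_grading d (g + h)"
proof -
  have "d q - d p = g + h" if "(M ** N) $ p $ q \<noteq> 0" for p q
  proof -
    have "(\<Sum>k\<in>UNIV. M $ p $ k * N $ k $ q) \<noteq> 0" using that by (simp add: matrix_matrix_mult_def)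
    then obtain k where "M $ p $ k * N $ k $ q \<noteq> 0"
      by (rule sum.not_neutral_contains_not_neutral)
    then have "M $ p $ k \<noteq> 0" "N $ k $ q \<noteq> 0" by auto
    then have "d k - d p = g" "d q - d k = h" using assms by (auto simp: elementary_grading_def)
    then show ?thesis by auto
  qed
  then show ?thesis by (simp add: elementary_grading_def)
qed

lemma elementary_grading_sum:
  fixes f :: "'b \<Rightarrow> 'f::comm_ring_1^'n::finite^'n"
  assumes "\<And>x. x \<in> S \<Longrightarrow> f x \<in> elementary_grading d g"
  shows "sum f S \<in> elementary_grading d g"
proof -
  have "d q - d p = g" if nz: "sum f S $ p $ q \<noteq> 0" for p q
  proof -
    have "(\<Sum>x\<in>S. f x $ p $ q) \<noteq> 0" using nz by simp
    then obtain x where "x \<in> S" "f x $ p $ q \<noteq> 0"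
      by (rule sum.not_neutral_contains_not_neutral)
    then show ?thesis using assms by (auto simp: elementary_grading_def)
  qed
  then show ?thesis by (simp add: elementary_grading_def)
qed

lemma elementary_grading_msmult:
  fixes M :: "'f::comm_ring_1^'n::finite^'n"
  shows "M \<in> elementary_grading d g \<Longrightarrow> msmult c M \<in> elementary_grading d g"
  unfolding elementary_grading_def using mult_not_zero by fastforce

lemma elementary_grading_one:
  fixes d :: "'n::finite \<Rightarrow> 'g::ab_group_add"
  shows "(mat 1 :: 'f::comm_ring_1^'n^'n) \<in> elementary_grading d 0"
  by (simp add: elementary_grading_def mat_def)

lemma eval_word_elementary:
  fixes d :: "'n::finite \<Rightarrow> 'g::ab_group_add" and \<sigma> :: "'g gvar \<Rightarrow> 'f::comm_ring_1^'n^'n"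
  assumes "\<And>x. \<sigma> x \<in> elementary_grading d (snd x)"
  shows "eval_word \<sigma> w \<in> elementary_grading d (wdeg w)"
  using assms by (induction w) (auto intro: elementary_grading_one elementary_grading_mult)

lemma eval_fa_elementary:
  fixes d :: "'n::finite \<Rightarrow> 'g::ab_group_add" and \<sigma> :: "'g gvar \<Rightarrow> 'f::comm_ring_1^'n^'n"
  assumes "\<And>x. \<sigma> x \<in> elementary_grading d (snd x)" "p \<in> fa_homog g"
  shows "eval_fa \<sigma> p \<in> elementary_grading d g"
  unfolding eval_fa_def
proof (intro elementary_grading_sum elementary_grading_msmult)
  fix w assume "w \<in> {w. p w \<noteq> 0}"
  then have "wdeg w = g" using assms(2) by (auto simp: fa_homog_def)
  then show "eval_word \<sigma> w \<in> elementary_grading d g" using eval_word_elementary[OF assms(1)] by metis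
qed

text \<open>For graded endomorphisms: \<open>\<tau> x\<close> evaluated at homogeneous matrices has
  degree \<open>snd x\<close> again, so substituting into \<open>p\<close> amounts to evaluating
  \<open>p\<close> at another admissible assignment.\<close>

lemma TG_ideal_graded_identities_elementary:
  fixes d :: "'n::finite \<Rightarrow> 'g::ab_group_add"
  shows "TG_ideal (graded_identities (elementary_grading d :: 'g \<Rightarrow> ('f::comm_ring_1^'n^'n) set))"
    (is "TG_ideal ?T")
  unfolding TG_ideal_def
proof (intro conjI ballI allI impI)
  show "?T \<subseteq> fa_polys" by (auto simp: graded_identities_def)
  show "(\<lambda>u. 0) \<in> ?T" by (simp add: graded_identities_def)
next
  fix p q assume "p \<in> ?T" "q \<in> ?T"
  then show "(\<lambda>u. p u + q u) \<in> ?T" by (simp add: graded_identities_def fa_polys_add eval_fa_add)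
next
  fix p f :: "('f, 'g) fpoly" assume "p \<in> ?T" "f \<in> fa_polys"
  then show "fa_mult f p \<in> ?T" "fa_mult p f \<in> ?T"
    by (auto simp: graded_identities_def fa_mult_polys eval_fa_mult)
next
  fix p and \<tau> :: "'g gvar \<Rightarrow> ('f, 'g) fpoly" assume p: "p \<in> ?T" and \<tau>: "graded_endo \<tau>"
  have pol: "\<tau> x \<in> fa_polys" for x using \<tau> unfolding graded_endo_def fa_homog_def by blast
  have "eval_fa \<sigma> (fa_subst \<tau> p) = 0" if "\<forall>x. \<sigma> x \<in> elementary_grading d (snd x)" for \<sigma> :: "'g gvar \<Rightarrow> 'f^'n^'n"
  proof -
    have "\<forall>x. eval_fa \<sigma> (\<tau> x) \<in> elementary_grading d (snd x)"
      using that \<tau> unfolding graded_endo_def by (blast intro: eval_fa_elementary)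
    then show ?thesis using p unfolding eval_fa_subst[OF pol] by (simp add: graded_identities_def)
  qed
  then show "fa_subst \<tau> p \<in> ?T" using fa_subst_polys[OF pol] by (simp add: graded_identities_def)
qed

lemma graded_identities_word_diff:
  fixes d :: "'n::finite \<Rightarrow> 'g::ab_group_add"
  assumes "inj d" "wdeg u = wdeg v" "\<And>s. steps s u = steps s v"
    "\<And>s. stays_in (range d) s u = stays_in (range d) s v"
  shows "(\<lambda>x. fa_word u x - fa_word v x)
    \<in> graded_identities (elementary_grading d :: 'g \<Rightarrow> ('f::comm_ring_1^'n^'n) set)"
proof -
  have "eval_fa \<sigma> (\<lambda>x. fa_word u x - fa_word v x) = 0"
    if "\<forall>x. \<sigma> x \<in> elementary_grading d (snd x)" for \<sigma> :: "'g gvar \<Rightarrow> 'f^'n^'n"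
  proof -
    have "\<And>x. \<sigma> x \<in> elementary_grading d (snd x)" using that by blast
    from eval_word_elementary_entry[OF assms(1) this]
    have "eval_word \<sigma> u = eval_word \<sigma> v" using assms(2-4) by (simp add: vec_eq_iff)
    then show ?thesis by (simp add: eval_fa_diff)
  qed
  then show ?thesis by (simp add: graded_identities_def fa_polys_diff)
qed

text \<open>\<open>A\<close> supplies the degrees for (iii) and \<open>d\<close> the grading in
  which identities are tested. Keeping them apart allows the generators of one grading to be
  compared with the identities of another one of smaller support.\<close>

lemma gen_identities_subset:
  fixes d :: "'n::finite \<Rightarrow> 'g::ab_group_add" and A :: "'g \<Rightarrow> ('f::comm_ring_1^'n^'n) set"
  assumes d: "inj d" and A: "\<And>g. A g = {0} \<Longrightarrow> elementary_grading d g \<subseteq> ({0} :: ('f^'n^'n) set)"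
  shows "gen_identities A \<subseteq> graded_identities (elementary_grading d)"
proof -
  have "fa_word [(1, g)] \<in> graded_identities (elementary_grading d :: 'g \<Rightarrow> ('f^'n^'n) set)"
    if "A g = {0}" for g
  proof -
    have "\<sigma> (1, g) = 0" if "\<forall>x. \<sigma> x \<in> elementary_grading d (snd x)" for \<sigma> :: "'g gvar \<Rightarrow> 'f^'n^'n"
      using that A[OF \<open>A g = {0}\<close>] by force
    then show ?thesis by (simp add: graded_identities_def)
  qed
  moreover have "(\<lambda>u. fa_word [(1,0),(2,0)] u - fa_word [(2,0),(1,0)] u)
      \<in> graded_identities (elementary_grading d :: 'g \<Rightarrow> ('f^'n^'n) set)"
    by (rule graded_identities_word_diff[OF d]) auto
  moreover have "(\<lambda>u. fa_word [(1,g),(2,-g),(3,g)] u - fa_word [(3,g),(2,-g),(1,g)] u)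
      \<in> graded_identities (elementary_grading d :: 'g \<Rightarrow> ('f^'n^'n) set)" for g
    by (rule graded_identities_word_diff[OF d]) (auto simp: algebra_simps)
  ultimately show ?thesis unfolding gen_identities_def by blast
qed

section \<open>Words modulo a T_G-ideal\<close>

definition word_cong :: "('f::comm_ring_1, 'g) fpoly set \<Rightarrow> 'g gvar list \<Rightarrow> 'g gvar list \<Rightarrow> bool" where
  "word_cong I u v \<longleftrightarrow> (\<lambda>x. fa_word u x - fa_word v x) \<in> I"

lemma TG_idealD:
  assumes "TG_ideal I"
  shows "(\<lambda>u. 0) \<in> I"
    and "p \<in> I \<Longrightarrow> q \<in> I \<Longrightarrow> (\<lambda>u. p u + q u) \<in> I"
    and "p \<in> I \<Longrightarrow> f \<in> fa_polys \<Longrightarrow> fa_mult f p \<in> I"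
    and "p \<in> I \<Longrightarrow> f \<in> fa_polys \<Longrightarrow> fa_mult p f \<in> I"
    and "p \<in> I \<Longrightarrow> graded_endo \<tau> \<Longrightarrow> fa_subst \<tau> p \<in> I"
  using assms by (auto simp: TG_ideal_def)

text \<open>\<open>TG_ideal\<close> lists no closure under scalars; a scalar multiple is a product
  with a constant polynomial.\<close>

lemma TG_ideal_scale: "TG_ideal I \<Longrightarrow> p \<in> I \<Longrightarrow> (\<lambda>u. c * p u) \<in> I"
  using TG_idealD(3)[of I p "\<lambda>u. c * fa_word [] u"] by (simp add: fa_mult_scalar fa_polys_scale)

lemma TG_ideal_sum: "TG_ideal I \<Longrightarrow> (\<And>x. x \<in> S \<Longrightarrow> f x \<in> I) \<Longrightarrow> (\<lambda>u. \<Sum>x\<in>S. f x u) \<in> I"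
  by (induction S rule: infinite_finite_induct) (auto intro: TG_idealD)

lemma TG_ideal_diff: "TG_ideal I \<Longrightarrow> p \<in> I \<Longrightarrow> q \<in> I \<Longrightarrow> (\<lambda>u. p u - q u) \<in> I"
  using TG_idealD(2)[of I p "\<lambda>u. (- 1) * q u"] TG_ideal_scale[of I q "- 1"] by simp

lemma TG_ideal_TG_generated:
  assumes "TG_ideal I" "S \<subseteq> I"
  shows "TG_ideal (TG_generated S)"
  unfolding TG_ideal_def
proof (intro conjI ballI allI impI)
  show "TG_generated S \<subseteq> fa_polys" using assms by (auto simp: TG_generated_def TG_ideal_def)
qed (auto simp: TG_generated_def intro: TG_idealD)

lemma subset_TG_generated: "S \<subseteq> TG_generated S"
  by (auto simp: TG_generated_def)

lemma TG_generated_subset: "TG_ideal I \<Longrightarrow> S \<subseteq> I \<Longrightarrow> TG_generated S \<subseteq> I"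
  by (auto simp: TG_generated_def)

lemma word_cong_refl: "TG_ideal I \<Longrightarrow> word_cong I u u"
  by (simp add: word_cong_def TG_idealD)

lemma word_cong_sym: "TG_ideal I \<Longrightarrow> word_cong I u v \<Longrightarrow> word_cong I v u"
  using TG_ideal_scale[of I "\<lambda>x. fa_word u x - fa_word v x" "- 1"] by (simp add: word_cong_def)

lemma word_cong_trans: "TG_ideal I \<Longrightarrow> word_cong I u v \<Longrightarrow> word_cong I v w \<Longrightarrow> word_cong I u w"
  using TG_idealD(2)[of I "\<lambda>x. fa_word u x - fa_word v x" "\<lambda>x. fa_word v x - fa_word w x"]
  by (simp add: word_cong_def)

lemma word_cong_append_left: "TG_ideal I \<Longrightarrow> word_cong I u v \<Longrightarrow> word_cong I (w @ u) (w @ v)"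
  using TG_idealD(3)[of I "\<lambda>x. fa_word u x - fa_word v x" "fa_word w"]
  by (simp add: word_cong_def fa_mult_diff_right fa_mult_word_word)

lemma word_cong_append_right: "TG_ideal I \<Longrightarrow> word_cong I u v \<Longrightarrow> word_cong I (u @ w) (v @ w)"
  using TG_idealD(4)[of I "\<lambda>x. fa_word u x - fa_word v x" "fa_word w"]
  by (simp add: word_cong_def fa_mult_diff_left fa_mult_word_word)

lemma word_cong_commute:
  assumes I: "TG_ideal I" and gen: "gen_identities A \<subseteq> I" and deg: "wdeg u = 0" "wdeg v = 0"
  shows "word_cong I (u @ v) (v @ u)"
proof -
  define \<tau> :: "'a gvar \<Rightarrow> ('b, 'a) fpoly"
    where "\<tau> x = (if x = (1,0) then fa_word u else if x = (2,0) then fa_word v else fa_word [x])" for x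
  have "graded_endo \<tau>"
    unfolding graded_endo_def \<tau>_def
    using fa_word_homog[of u] fa_word_homog[of v] fa_word_homog[of "[x]" for x] deg by auto
  moreover have "(\<lambda>u. fa_word [(1,0),(2,0)] u - fa_word [(2,0),(1,0)] u) \<in> I"
    using gen by (auto simp: gen_identities_def)
  ultimately have "fa_subst \<tau> (\<lambda>u. fa_word [(1,0),(2,0)] u - fa_word [(2,0),(1,0)] u) \<in> I"
    using TG_idealD(5)[OF I] by blast
  then show ?thesis
    by (subst (asm) fa_subst_word_diff) (auto simp: \<tau>_def word_cong_def fa_mult_word_word)
qed

text \<open>Degree 0 is not covered by (ii) but follows from (i) by two commutations. Including it
  spares the trail argument a case distinction on closed pieces.\<close>

lemma word_cong_reverse:
  assumes I: "TG_ideal I" and gen: "gen_identities A \<subseteq> I"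
    and deg: "wdeg v = - wdeg u" "wdeg w = wdeg u"
  shows "word_cong I (u @ v @ w) (w @ v @ u)"
proof (cases "wdeg u = 0")
  case True
  then have z: "wdeg u = 0" "wdeg v = 0" "wdeg w = 0" using deg by auto
  have "word_cong I (u @ v @ w) (v @ w @ u)"
    using word_cong_commute[OF I gen, of u "v @ w"] z by simp
  moreover have "word_cong I ((v @ w) @ u) ((w @ v) @ u)"
    using word_cong_commute[OF I gen, of v w] z by (intro word_cong_append_right[OF I]) auto
  ultimately show ?thesis using word_cong_trans[OF I] by simp
next
  case False
  define g where "g = wdeg u"
  define \<tau> :: "'a gvar \<Rightarrow> ('b, 'a) fpoly"
    where "\<tau> x = (if x = (1,g) then fa_word u else if x = (2,-g) then fa_word v
      else if x = (3,g) then fa_word w else fa_word [x])" for x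
  have "graded_endo \<tau>"
    unfolding graded_endo_def \<tau>_def
    using fa_word_homog[of u] fa_word_homog[of v] fa_word_homog[of w] fa_word_homog[of "[x]" for x] deg
    by (auto simp: g_def)
  moreover have "(\<lambda>u. fa_word [(1,g),(2,-g),(3,g)] u - fa_word [(3,g),(2,-g),(1,g)] u) \<in> I"
    using gen False by (auto simp: gen_identities_def g_def)
  ultimately have "fa_subst \<tau> (\<lambda>u. fa_word [(1,g),(2,-g),(3,g)] u - fa_word [(3,g),(2,-g),(1,g)] u) \<in> I"
    using TG_idealD(5)[OF I] by blast
  then show ?thesis
    by (subst (asm) fa_subst_word_diff) (auto simp: \<tau>_def word_cong_def fa_mult_word_word)
qed

lemma mem_stepsE:
  assumes "z \<in># steps s w"
  obtains u v where "w = u @ fst z # v" "s + wdeg u = snd z"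
  using assms
proof (induction w arbitrary: s thesis)
  case (Cons x w)
  show ?case
  proof (cases "z = (x, s)")
    case True
    then show ?thesis using Cons.prems(1)[of "[]" w] by simp
  next
    case False
    then have "z \<in># steps (s + snd x) w" using Cons.prems(2) by simp
    then obtain u v where "w = u @ fst z # v" "s + snd x + wdeg u = snd z" using Cons.IH by blast
    then show ?thesis using Cons.prems(1)[of "x # u" v] by (simp add: algebra_simps)
  qed
qed simp

text \<open>Two Eulerian trails of the same labelled multigraph from the same vertex are
  connected by the moves of \<open>word_cong_reverse\<close>: to bring the first letter \<open>x\<close> of \<open>u\<close>
  to the front of \<open>w = w1 x w2\<close>, either the closed trail \<open>w1\<close> meets the rest of \<open>w\<close> again
  and the two pieces up to the meeting point are exchanged, or
  \<open>u\<close> could never return to the edges of \<open>w1\<close>.\<close>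

lemma word_cong_if_steps_eq:
  assumes I: "TG_ideal I" and gen: "gen_identities A \<subseteq> I"
  shows "steps s u = steps s w \<Longrightarrow> word_cong I u w"
proof (induction u arbitrary: s w)
  case Nil
  then show ?case using word_cong_refl[OF I] by (cases w) auto
next
  case (Cons x u)
  have front: "word_cong I (x # u) (x # v)" if "steps s (x # v) = steps s (x # u)" for v
  proof -
    have "steps (s + snd x) u = steps (s + snd x) v" using that by simp
    from word_cong_append_left[OF I Cons.IH[OF this], of "[x]"] show ?thesis by simp
  qed
  \<comment> \<open>The first step of \<open>x # u\<close> occurs somewhere in \<open>w\<close>; the
    part \<open>w1\<close> before it leads from \<open>s\<close> back to \<open>s\<close>.\<close>
  have "(x, s) \<in># steps s w" using Cons.prems by (metis steps.simps(2) union_single_eq_member)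
  then obtain w1 w2 where w: "w = w1 @ x # w2" and deg1: "wdeg w1 = 0"
    by (rule mem_stepsE) auto
  show ?case
  proof (cases "w1 = []")
    case True
    then show ?thesis using front[of w2] Cons.prems w by simp
  next
    case False
    \<comment> \<open>A meeting vertex of \<open>w1\<close> and \<open>w2\<close>: the walks
      \<open>p\<close> and \<open>x # r\<close> lead from \<open>s\<close> to the same
      place.\<close>
    have "\<exists>p q r t. w1 = p @ q \<and> w2 = r @ t \<and> wdeg p = snd x + wdeg r"
    proof (rule ccontr)
      assume contra: "\<not> ?thesis"
      let ?s = "s + snd x"
      have eq: "steps ?s u = steps s w1 + steps ?s w2"
        using Cons.prems by (simp add: w steps_append deg1)
      \<comment> \<open>Invariant: a trail made of the remaining steps and starting on
        \<open>w2\<close> only ever leaves vertices of \<open>w2\<close>, because by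
        \<open>contra\<close> no step of \<open>w1\<close> starts at such a vertex.\<close>
      have src: "\<exists>r t. w2 = r @ t \<and> b = ?s + wdeg r" if "(y, b) \<in># steps a v"
        "\<exists>r t. w2 = r @ t \<and> a = ?s + wdeg r" "steps a v \<subseteq># steps ?s u" for y a b v
        using that
      proof (induction v arbitrary: a)
        case (Cons z v)
        show ?case
        proof (cases "(y, b) = (z, a)")
          case False
          have "(z, a) \<in># steps ?s u"
            using Cons.prems(3) by (metis mset_subset_eqD steps.simps(2) union_single_eq_member)
          then consider "(z, a) \<in># steps s w1" | "(z, a) \<in># steps ?s w2" unfolding eq by auto
          then have "\<exists>r t. w2 = r @ t \<and> a + snd z = ?s + wdeg r"
          proof cases
            case 1
            then obtain p q where "w1 = p @ z # q" "s + wdeg p = a" by (rule mem_stepsE) auto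
            moreover obtain r t where "w2 = r @ t" "a = ?s + wdeg r" using Cons.prems(2) by blast
            ultimately have False using contra by (auto simp: add.assoc)
            then show ?thesis ..
          next
            case 2
            then obtain p q where "w2 = p @ z # q" "?s + wdeg p = a" by (rule mem_stepsE) auto
            then show ?thesis by (intro exI[of _ "p @ [z]"] exI[of _ q]) (auto simp: algebra_simps)
          qed
          moreover have "steps (a + snd z) v \<subseteq># steps ?s u"
            using Cons.prems(3) by (metis add_mset_remove_trivial diff_subset_eq_self steps.simps(2) subset_mset.order_trans)
          moreover have "(y, b) \<in># steps (a + snd z) v" using Cons.prems(1) False by auto
          ultimately show ?thesis using Cons.IH by blast
        qed (use Cons.prems in auto)
      qed simp
      \<comment> \<open>As \<open>w1\<close> is nonempty, \<open>u\<close> has to leave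
        \<open>s\<close>. By the invariant \<open>s\<close> lies on \<open>w2\<close>, and the empty
        \<open>p\<close> is a meeting point after all.\<close>
      obtain y v where v: "w1 = y # v" using False by (cases w1) auto
      have "(y, s) \<in># steps ?s u" unfolding eq v by simp
      then have "\<exists>r t. w2 = r @ t \<and> s = ?s + wdeg r"
        by (rule src) (auto intro: exI[of _ "[]"])
      then show False using contra[simplified] by (metis add.assoc add.right_neutral add_left_cancel append_Nil wdeg_Nil)
    qed
    then obtain p q r t where pq: "w1 = p @ q" and rt: "w2 = r @ t" and deg: "wdeg p = snd x + wdeg r"
      by blast
    have degq: "wdeg q = - wdeg p" using deg1 pq by (simp add: eq_neg_iff_add_eq_0 add.commute)
    \<comment> \<open>The pieces \<open>p\<close> and \<open>x # r\<close> have equal degree and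
      enclose \<open>q\<close> of opposite degree, so exchanging them brings \<open>x\<close> to the
      front.\<close>
    have "word_cong I (p @ q @ (x # r)) ((x # r) @ q @ p)"
      using deg degq by (intro word_cong_reverse[OF I gen]) auto
    from word_cong_append_right[OF I this, of t]
    have c: "word_cong I w (x # (r @ q @ p @ t))" by (simp add: w pq rt)
    have "steps s (x # (r @ q @ p @ t)) = steps s w"
    proof -
      have e: "s + snd x + wdeg r = s + wdeg p" "s + wdeg p + wdeg q = s"
        by (simp_all add: deg degq add.assoc)
      show ?thesis by (simp add: w pq rt steps_append add.assoc[symmetric] e)
    qed
    then have "word_cong I (x # u) (x # (r @ q @ p @ t))" using Cons.prems by (intro front) (rule trans, simp_all)
    then show ?thesis using word_cong_trans[OF I] word_cong_sym[OF I] c by blast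
  qed
qed

section \<open>Sufficiency of the generators\<close>

text \<open>Vanishing power sums make the sum of \<open>a m * poly q (of_nat m)\<close> vanish for
  every polynomial \<open>q\<close>; choose \<open>q\<close> with root set \<open>N - {n}\<close>.
  Characteristic 0 keeps distinct naturals distinct in the field.\<close>

lemma sum_powers_of_nat_eq_0:
  fixes a :: "nat \<Rightarrow> 'f::field_char_0"
  assumes fin: "finite N" and z: "\<And>t. (\<Sum>n\<in>N. a n * of_nat n ^ t) = 0" and n: "n \<in> N"
  shows "a n = 0"
proof -
  define q :: "'f poly" where "q = (\<Prod>m\<in>N - {n}. [:- of_nat m, 1:])"
  have "(\<Sum>m\<in>N. a m * poly q (of_nat m)) = (\<Sum>m\<in>N. \<Sum>t\<le>degree q. coeff q t * (a m * of_nat m ^ t))"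
    by (simp add: poly_altdef sum_distrib_left algebra_simps)
  also have "\<dots> = (\<Sum>t\<le>degree q. coeff q t * (\<Sum>m\<in>N. a m * of_nat m ^ t))"
    by (subst sum.swap) (simp add: sum_distrib_left)
  also have "\<dots> = 0" by (simp add: z)
  finally have "(\<Sum>m\<in>N. a m * poly q (of_nat m)) = 0" .
  moreover have "(\<Sum>m\<in>N. a m * poly q (of_nat m)) = (\<Sum>m\<in>{n}. a m * poly q (of_nat m))"
    using fin n by (intro sum.mono_neutral_right) (auto simp: q_def poly_prod prod_zero_iff)
  ultimately have "a n * poly q (of_nat n) = 0" by simp
  moreover have "poly q (of_nat n) \<noteq> 0" using fin by (auto simp: q_def poly_prod prod_zero_iff)
  ultimately show ?thesis by simp
qed

text \<open>Substituting powers of distinct primes turns distinct monomials into powers of distinct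
  natural numbers.\<close>

lemma monomials_independent:
  fixes a :: "'s multiset \<Rightarrow> 'f::field_char_0"
  assumes fin: "finite M" and z: "\<And>\<xi> :: 's \<Rightarrow> 'f. (\<Sum>m\<in>M. a m * (\<Prod>x\<in>#m. \<xi> x)) = 0" and m: "m \<in> M"
  shows "a m = 0"
proof -
  define S where "S = (\<Union>m\<in>M. set_mset m)"
  have finS: "finite S" using fin by (simp add: S_def)
  obtain B where B: "B \<subseteq> {p::nat. prime p}" "finite B" "card B = card S"
    using infinite_arbitrarily_large[OF primes_infinite] by metis
  then obtain \<pi> where \<pi>: "bij_betw \<pi> S B" using finite_same_card_bij[OF finS B(2)] by metis
  define N where "N m = (\<Prod>x\<in>#m. \<pi> x)" for m
  have pr: "prime (\<pi> x)" if "x \<in> S" for x using \<pi> B(1) that by (auto simp: bij_betw_def)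
  \<comment> \<open>Unique factorization reads the monomial back from the number \<open>N m\<close>,
    whence \<open>N\<close> is injective.\<close>
  have rec: "image_mset (inv_into S \<pi>) (prime_factorization (N m)) = m" if "m \<in> M" for m
  proof -
    have sub: "set_mset m \<subseteq> S" using that by (auto simp: S_def)
    have "prime_factorization (N m) = image_mset \<pi> m"
      unfolding N_def using sub pr by (intro prime_factorization_prod_mset_primes) auto
    then have "image_mset (inv_into S \<pi>) (prime_factorization (N m)) = image_mset (\<lambda>x. inv_into S \<pi> (\<pi> x)) m"
      by (simp add: image_mset.compositionality comp_def)
    also have "\<dots> = image_mset id m"
      using sub \<pi> by (intro image_mset_cong) (auto simp: bij_betw_def inv_into_f_f)
    finally show ?thesis by simp
  qed
  have inj: "inj_on N M" 
    by (rule inj_on_inverseI[where g = "\<lambda>k. image_mset (inv_into S \<pi>) (prime_factorization k)"]) (rule rec)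
  \<comment> \<open>Substituting the \<open>t\<close>-th powers of the primes raises each
    \<open>N m\<close> to the power \<open>t\<close>, so the hypothesis yields every power
    sum.\<close>
  have pow: "(\<Prod>x\<in>#m. (of_nat (\<pi> x) :: 'f) ^ t) = of_nat (N m) ^ t" for m t
    by (induction m) (simp_all add: N_def power_mult_distrib)
  have "a (inv_into M N (N m)) = 0"
  proof (rule sum_powers_of_nat_eq_0[of "N ` M" "\<lambda>n. a (inv_into M N n)" "N m"])
    fix t
    have "(\<Sum>n\<in>N ` M. a (inv_into M N n) * of_nat n ^ t) = (\<Sum>m\<in>M. a m * (\<Prod>x\<in>#m. (of_nat (\<pi> x)) ^ t))"
      using inj by (simp add: sum.reindex pow)
    then show "(\<Sum>n\<in>N ` M. a (inv_into M N n) * of_nat n ^ t) = 0" using z by simp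
  qed (use fin m in auto)
  then show ?thesis using inj m by simp
qed

lemma mem_steps_stays_in:
  "stays_in D s w \<Longrightarrow> (x, t) \<in># steps s w \<Longrightarrow> t \<in> D \<and> t + snd x \<in> D"
proof (induction D s w rule: stays_in.induct)
  case (2 D s y w)
  show ?case
  proof (cases "(x, t) = (y, s)")
    case True
    then show ?thesis using "2.prems"(1) stays_in_start by auto
  next
    case False
    then show ?thesis using 2 by auto
  qed
qed simp

text \<open>The sum is the coefficient of the monomial \<open>m\<close> in entry (i, j) of
  \<open>p\<close> evaluated at generic homogeneous matrices. That entry vanishes for all values of
  the generic entries, so each coefficient is 0.\<close>

lemma graded_identities_coeff_sum:
  fixes d :: "'n::finite \<Rightarrow> 'g::ab_group_add" and p :: "('f::field_char_0, 'g) fpoly"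
  assumes d: "inj d" and p: "p \<in> graded_identities (elementary_grading d :: 'g \<Rightarrow> ('f^'n^'n) set)"
  shows "(\<Sum>w | p w \<noteq> 0 \<and> stays_in (range d) (d i) w \<and> d j = d i + wdeg w \<and> steps (d i) w = m. p w) = 0"
proof -
  define V where "V = {w. p w \<noteq> 0 \<and> stays_in (range d) (d i) w \<and> d j = d i + wdeg w}"
  have fin: "finite {w. p w \<noteq> 0}" using p by (auto simp: graded_identities_def fa_polys_def)
  then have finV: "finite V" unfolding V_def by (rule rev_finite_subset) auto
  define a where "a m = (\<Sum>w | w \<in> V \<and> steps (d i) w = m. p w)" for m
  have sum0: "(\<Sum>m\<in>steps (d i) ` V. a m * (\<Prod>z\<in>#m. \<xi> z)) = 0" for \<xi> :: "'g gvar \<times> 'g \<Rightarrow> 'f"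
  proof -
    \<comment> \<open>Generic homogeneous matrices: the entry of \<open>\<sigma> x\<close> in row
      \<open>k\<close> at the position allowed by the degree is the free value
      \<open>\<xi> (x, d k)\<close>.\<close>
    define \<sigma> :: "'g gvar \<Rightarrow> 'f^'n^'n"
      where "\<sigma> x = (\<chi> k l. if d l - d k = snd x then \<xi> (x, d k) else 0)" for x
    have \<sigma>: "\<sigma> x \<in> elementary_grading d (snd x)" for x
      by (auto simp: \<sigma>_def elementary_grading_def)
    have ev: "eval_word \<sigma> w $ i $ j =
        (if stays_in (range d) (d i) w \<and> d j = d i + wdeg w then \<Prod>z\<in>#steps (d i) w. \<xi> z else 0)" for w
    proof (cases "stays_in (range d) (d i) w")
      case True
      have "image_mset (\<lambda>z. \<sigma> (fst z) $ inv d (snd z) $ inv d (snd z + snd (fst z))) (steps (d i) w)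
        = image_mset \<xi> (steps (d i) w)"
      proof (rule image_mset_cong)
        fix z assume "z \<in># steps (d i) w"
        then have "(fst z, snd z) \<in># steps (d i) w" by simp
        from mem_steps_stays_in[OF True this]
        show "\<sigma> (fst z) $ inv d (snd z) $ inv d (snd z + snd (fst z)) = \<xi> z"
          by (simp add: \<sigma>_def f_inv_into_f)
      qed
      then show ?thesis using eval_word_elementary_entry[OF d \<sigma>] by simp
    qed (simp add: eval_word_elementary_entry[OF d \<sigma>])
    have "eval_fa \<sigma> p = 0" using p \<sigma> by (auto simp: graded_identities_def)
    then have "0 = eval_fa \<sigma> p $ i $ j" by simp
    also have "\<dots> = (\<Sum>w\<in>{w. p w \<noteq> 0}. p w * eval_word \<sigma> w $ i $ j)" by (simp add: eval_fa_def)
    also have "\<dots> = (\<Sum>w\<in>V. p w * (\<Prod>z\<in>#steps (d i) w. \<xi> z))"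
      using fin by (intro sum.mono_neutral_cong_right) (auto simp: ev V_def)
    also have "\<dots> = (\<Sum>m\<in>steps (d i) ` V. \<Sum>w | w \<in> V \<and> steps (d i) w = m. p w * (\<Prod>z\<in>#steps (d i) w. \<xi> z))"
      by (rule sum.image_gen[OF finV])
    also have "\<dots> = (\<Sum>m\<in>steps (d i) ` V. a m * (\<Prod>z\<in>#m. \<xi> z))"
      by (simp add: a_def sum_distrib_right)
    finally show ?thesis by simp
  qed
  have "a m = 0"
  proof (cases "m \<in> steps (d i) ` V")
    case True
    then show ?thesis using monomials_independent[OF finite_imageI[OF finV] sum0] by blast
  next
    case False
    then have "{w. w \<in> V \<and> steps (d i) w = m} = {}" by auto
    then show ?thesis unfolding a_def by (metis sum.empty)
  qed
  moreover have "{w. w \<in> V \<and> steps (d i) w = m} =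
    {w. p w \<noteq> 0 \<and> stays_in (range d) (d i) w \<and> d j = d i + wdeg w \<and> steps (d i) w = m}"
    by (auto simp: V_def)
  ultimately show ?thesis by (simp add: a_def)
qed

text \<open>Induction on the number of words in \<open>p\<close>. Pick a word: if it labels no walk,
  its term lies in \<open>I\<close> by \<open>mono\<close>. Otherwise fix a start vertex; the words
  of \<open>p\<close> with the same steps from there are congruent and their coefficients add up to
  0, so this whole part of \<open>p\<close> is a combination of differences in
  \<open>I\<close>.\<close>

lemma graded_identities_subset_ideal:
  fixes d :: "'n::finite \<Rightarrow> 'g::ab_group_add"
    and A :: "'g \<Rightarrow> ('f::field_char_0^'n^'n) set" and I :: "('f, 'g) fpoly set"
  assumes d: "inj d" and I: "TG_ideal I" and gen: "gen_identities A \<subseteq> I"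
    and IT: "I \<subseteq> graded_identities (elementary_grading d :: 'g \<Rightarrow> ('f^'n^'n) set)"
    and mono: "\<And>w. (\<And>s. \<not> stays_in (range d) s w) \<Longrightarrow> fa_word w \<in> I"
  shows "graded_identities (elementary_grading d :: 'g \<Rightarrow> ('f^'n^'n) set) \<subseteq> I" (is "?T \<subseteq> I")
proof
  fix p assume "p \<in> ?T"
  then show "p \<in> I"
  proof (induction "card {w. p w \<noteq> 0}" arbitrary: p rule: less_induct)
    case less
    have fin: "finite {w. p w \<noteq> 0}" using less.prems by (auto simp: graded_identities_def fa_polys_def)
    have T: "TG_ideal ?T" by (rule TG_ideal_graded_identities_elementary)
    \<comment> \<open>Removing from \<open>p\<close> a nonempty part that lies in \<open>I\<close>
      leaves an identity with fewer words.\<close>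
    have red: "p \<in> I" if q: "q \<in> I" and W: "W \<noteq> {}" "W \<subseteq> {w. p w \<noteq> 0}"
      and qW: "\<And>w. q w = (if w \<in> W then p w else 0)" for q W
    proof -
      have "{w. p w - q w \<noteq> 0} = {w. p w \<noteq> 0} - W" using W by (auto simp: qW)
      then have "{w. p w - q w \<noteq> 0} \<subset> {w. p w \<noteq> 0}" using W by auto
      then have "card {w. p w - q w \<noteq> 0} < card {w. p w \<noteq> 0}" using fin by (rule psubset_card_mono[rotated])
      moreover have "(\<lambda>u. p u - q u) \<in> ?T" using less.prems q IT by (intro TG_ideal_diff[OF T]) auto
      ultimately have "(\<lambda>u. p u - q u) \<in> I" by (rule less.hyps)
      from TG_idealD(2)[OF I this q] show ?thesis by simp
    qed
    show ?case
    proof (cases "\<exists>w. p w \<noteq> 0")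
      case False
      then have "p = (\<lambda>u. 0)" by auto
      then show ?thesis using TG_idealD(1)[OF I] by simp
    next
      case True
      then obtain w0 where w0: "p w0 \<noteq> 0" by blast
      show ?thesis
      proof (cases "\<exists>s. stays_in (range d) s w0")
        case False
        then have "(\<lambda>u. p w0 * fa_word w0 u) \<in> I" using mono TG_ideal_scale[OF I] by blast
        then show ?thesis by (rule red[of _ "{w0}"]) (use w0 in \<open>auto simp: fa_word_def\<close>)
      next
        case True
        then obtain s where s: "stays_in (range d) s w0" by blast
        then obtain i j where i: "s = d i" and j: "d j = d i + wdeg w0"
          using stays_in_start stays_in_end by (metis rangeE)
        define W where "W = {w. p w \<noteq> 0 \<and> stays_in (range d) (d i) w \<and> d j = d i + wdeg w
          \<and> steps (d i) w = steps (d i) w0}"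
        have finW: "finite W" unfolding W_def by (rule finite_subset[OF _ fin]) auto
        have sum0: "(\<Sum>w\<in>W. p w) = 0"
          unfolding W_def by (rule graded_identities_coeff_sum[OF d less.prems])
        have "word_cong I w w0" if "w \<in> W" for w
          using that word_cong_if_steps_eq[OF I gen] by (auto simp: W_def)
        \<comment> \<open>The terms with \<open>w0\<close> cancel because the coefficients over
          \<open>W\<close> sum to 0, so this combination is exactly \<open>p\<close> restricted to
          \<open>W\<close>.\<close>
        then have "(\<lambda>u. \<Sum>w\<in>W. p w * (fa_word w u - fa_word w0 u)) \<in> I"
          by (intro TG_ideal_sum[OF I] TG_ideal_scale[OF I]) (simp add: word_cong_def)
        moreover have "(\<Sum>w\<in>W. p w * (fa_word w u - fa_word w0 u)) = (if u \<in> W then p u else 0)" for u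
        proof -
          have "(\<Sum>w\<in>W. p w * (fa_word w u - fa_word w0 u)) = (\<Sum>w\<in>W. p w * fa_word w u) - (\<Sum>w\<in>W. p w) * fa_word w0 u"
            by (simp add: right_diff_distrib sum_subtractf sum_distrib_right)
          also have "\<dots> = (\<Sum>w\<in>W. if u = w then p w else 0)"
            by (simp add: sum0 fa_word_def if_distrib cong: if_cong)
          finally show ?thesis using finW by simp
        qed
        moreover have "w0 \<in> W" using w0 s i j by (auto simp: W_def)
        ultimately show ?thesis by (intro red[of _ W]) (auto simp: W_def)
      qed
    qed
  qed
qed

section \<open>Monomial identities and the support of the grading\<close>

lemma elementary_grading_eq_zero_iff:
  fixes d :: "'n::finite \<Rightarrow> 'g::ab_group_add"
  shows "elementary_grading d g = ({0} :: ('f::field^'n^'n) set) \<longleftrightarrow> (\<forall>p q. d q - d p \<noteq> g)"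
proof
  assume z: "elementary_grading d g = ({0} :: ('f^'n^'n) set)"
  show "\<forall>p q. d q - d p \<noteq> g"
  proof (intro allI notI)
    fix p q assume "d q - d p = g"
    then have "(\<chi> k l. if k = p \<and> l = q then 1 else 0 :: 'f^'n^'n) \<in> elementary_grading d g"
      by (auto simp: elementary_grading_def)
    then have "(\<chi> k l. if k = p \<and> l = q then 1 else 0 :: 'f^'n^'n) = 0" using z by blast
    then have "(\<chi> k l. if k = p \<and> l = q then 1 else 0 :: 'f^'n^'n) $ p $ q = 0" by simp
    then show False by simp
  qed
qed (auto simp: elementary_grading_def vec_eq_iff)

lemma fa_word_zero_component_in_ideal:
  assumes I: "TG_ideal I" and gen: "gen_identities A \<subseteq> I" and z: "A (wdeg v) = {0}"
  shows "fa_word (u @ v @ w) \<in> I"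
proof -
  define \<tau> :: "'a gvar \<Rightarrow> ('b, 'a) fpoly"
    where "\<tau> x = (if x = (1,wdeg v) then fa_word v else fa_word [x])" for x
  have "graded_endo \<tau>"
    unfolding graded_endo_def \<tau>_def
    using fa_word_homog[of v] fa_word_homog[of "[x]" for x] by auto
  moreover have "fa_word [(1,wdeg v)] \<in> I" using gen z by (auto simp: gen_identities_def)
  ultimately have "fa_subst \<tau> (fa_word [(1,wdeg v)]) \<in> I" using TG_idealD(5)[OF I] by blast
  then have "fa_word v \<in> I" by (simp add: fa_subst_word \<tau>_def fa_mult_word_word)
  then have "fa_mult (fa_mult (fa_word u) (fa_word v)) (fa_word w) \<in> I"
    by (intro TG_idealD(3,4)[OF I]) auto
  then show ?thesis by (simp add: fa_mult_word_word)
qed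

lemma stays_inI: "(\<And>i. i \<le> length w \<Longrightarrow> s + wdeg (take i w) \<in> D) \<Longrightarrow> stays_in D s w"
proof (induction D s w rule: stays_in.induct)
  case (2 D s x w)
  have "s \<in> D" using "2.prems"[of 0] by simp
  moreover have "stays_in D (s + snd x) w"
  proof (rule "2.IH")
    fix i assume "i \<le> length w"
    then show "s + snd x + wdeg (take i w) \<in> D" using "2.prems"[of "Suc i"] by (simp add: add.assoc)
  qed
  ultimately show ?case by simp
next
  case (1 D s)
  then show ?case using "1.prems"[of 0] by simp
qed

text \<open>The hypothesis \<open>transl\<close> says that every product of variables all of whose factors have
  degree in the support is the label of a walk on \<open>range d\<close>, i.e. that there are no monomial
  identities beyond the consequences of (iii).\<close>

lemma graded_identities_generated:
  fixes d :: "'n::finite \<Rightarrow> 'g::ab_group_add"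
  assumes d: "inj d"
    and transl: "\<And>S. finite S \<Longrightarrow> S \<noteq> {} \<Longrightarrow> (\<And>x y. x \<in> S \<Longrightarrow> y \<in> S \<Longrightarrow> \<exists>p q. y - x = d q - d p)
      \<Longrightarrow> \<exists>t. \<forall>x\<in>S. t + x \<in> range d"
  shows "graded_identities (elementary_grading d) =
    TG_generated (gen_identities (elementary_grading d :: 'g \<Rightarrow> ('f::field_char_0^'n^'n) set))"
    (is "?T = TG_generated ?gen")
proof
  have T: "TG_ideal ?T" by (rule TG_ideal_graded_identities_elementary)
  have gen: "?gen \<subseteq> ?T" using d by (intro gen_identities_subset) auto
  show sub: "TG_generated ?gen \<subseteq> ?T" by (rule TG_generated_subset[OF T gen])
  have J: "TG_ideal (TG_generated ?gen)" by (rule TG_ideal_TG_generated[OF T gen])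
  have genJ: "?gen \<subseteq> TG_generated ?gen" by (rule subset_TG_generated)
  show "?T \<subseteq> TG_generated ?gen"
  proof (rule graded_identities_subset_ideal[OF d J genJ sub])
    fix w assume no: "\<And>s. \<not> stays_in (range d) s w"
    show "fa_word w \<in> TG_generated ?gen"
    proof (rule ccontr)
      assume w: "fa_word w \<notin> TG_generated ?gen"
      have sup: "\<exists>p q. d q - d p = wdeg v" if "w = u @ v @ u'" for u v u'
        using fa_word_zero_component_in_ideal[OF J genJ, of v u u'] w that
        unfolding elementary_grading_eq_zero_iff by blast
      \<comment> \<open>Degrees of all prefixes. Two of them differ, up to sign, by the degree of a
        factor of \<open>w\<close>, which lies in the support, and the support is symmetric. A
        translation of \<open>S\<close> into \<open>range d\<close> is a start vertex for a walk
        with label \<open>w\<close>.\<close>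
      define S where "S = (\<lambda>i. wdeg (take i w)) ` {..length w}"
      have diff: "\<exists>p q. wdeg (take (i + k) w) - wdeg (take i w) = d q - d p" for i k
      proof -
        have "w = take i w @ take k (drop i w) @ drop (i + k) w"
          by (metis append_assoc append_take_drop_id take_add)
        from sup[OF this] show ?thesis by (metis add_diff_cancel_left' take_add wdeg_append)
      qed
      have "\<exists>p q. wdeg (take j w) - wdeg (take i w) = d q - d p" for i j
      proof (cases "i \<le> j")
        case True
        then show ?thesis using diff[of i "j - i"] by simp
      next
        case False
        then show ?thesis using diff[of j "i - j"] by (metis le_add_diff_inverse minus_diff_eq nat_le_linear)
      qed
      then have "\<exists>t. \<forall>x\<in>S. t + x \<in> range d" by (intro transl) (auto simp: S_def)
      then obtain t where "\<forall>x\<in>S. t + x \<in> range d" ..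
      then have "stays_in (range d) t w" by (intro stays_inI) (auto simp: S_def)
      then show False using no by blast
    qed
  qed
qed

section \<open>Elementary gradings on 4 by 4 matrices\<close>

lemma four_eq_0: "(4::4) = 0"
  by simp

lemma forall_idx4: "(\<forall>i::4. P i) \<longleftrightarrow> P 0 \<and> P 1 \<and> P 2 \<and> P 3"
  using forall_4[of P] by (auto simp: four_eq_0)

lemma range_idx4: "range (d :: 4 \<Rightarrow> 'a) = {d 0, d 1, d 2, d 3}"
proof -
  have "x \<in> range d \<longleftrightarrow> x \<in> {d 0, d 1, d 2, d 3}" for x
    using forall_idx4[of "\<lambda>i. x \<noteq> d i"] by auto
  then show ?thesis by blast
qed

text \<open>The generators for \<open>d\<close> are identities of the grading by \<open>d'\<close>,
  because the support of the latter is contained in that of the former; hence so are all identities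
  for \<open>d\<close>. A monomial that runs through all degrees of \<open>d'\<close> is no identity
  there, thus none for \<open>d\<close>, and a walk on \<open>range d\<close> with this label is the
  translated tuple.\<close>

lemma translate_if_generated:
  fixes d d' :: "4 \<Rightarrow> 'g::ab_group_add"
  assumes d: "inj d" and d': "inj d'"
    and gen: "graded_identities (elementary_grading d)
      = TG_generated (gen_identities (elementary_grading d :: 'g \<Rightarrow> ('f::field^4^4) set))"
    and sub: "\<And>p q. \<exists>p' q'. d' q - d' p = d q' - d p'"
  shows "\<exists>t. \<forall>i. t + d' i \<in> range d"
proof -
  let ?T = "\<lambda>e. graded_identities (elementary_grading e :: 'g \<Rightarrow> ('f^4^4) set)"
  have "gen_identities (elementary_grading d :: 'g \<Rightarrow> ('f^4^4) set) \<subseteq> ?T d'"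
  proof (rule gen_identities_subset[OF d'])
    fix g assume "elementary_grading d g = ({0} :: ('f^4^4) set)"
    then have "elementary_grading d' g = ({0} :: ('f^4^4) set)"
      unfolding elementary_grading_eq_zero_iff using sub by metis
    then show "elementary_grading d' g \<subseteq> ({0} :: ('f^4^4) set)" by simp
  qed
  then have incl: "?T d \<subseteq> ?T d'"
    unfolding gen by (intro TG_generated_subset TG_ideal_graded_identities_elementary)
  \<comment> \<open>The word labels the walk \<open>d' 0\<close>, \<open>d' 1\<close>,
    \<open>d' 2\<close>, \<open>d' 3\<close>. With ones at all admissible positions in
    \<open>\<sigma>\<close>, that walk contributes the entry 1.\<close>
  define w :: "'g gvar list" where "w = [(0, d' 1 - d' 0), (0, d' 2 - d' 1), (0, d' 3 - d' 2)]"
  define \<sigma> :: "'g gvar \<Rightarrow> 'f^4^4" where "\<sigma> x = (\<chi> k l. if d' l - d' k = snd x then 1 else 0)" for x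
  have \<sigma>: "\<sigma> x \<in> elementary_grading d' (snd x)" for x
    by (auto simp: \<sigma>_def elementary_grading_def)
  have "eval_word \<sigma> w $ 0 $ 3 = 1"
    unfolding eval_word_elementary_entry[OF d' \<sigma>] by (simp add: w_def inv_f_f[OF d']) (simp add: \<sigma>_def)
  then have "fa_word w \<notin> ?T d'" 
  proof -
    have "eval_fa \<sigma> (fa_word w) \<noteq> 0" using \<open>eval_word \<sigma> w $ 0 $ 3 = 1\<close> by auto
    then show ?thesis using \<sigma> unfolding graded_identities_def by blast
  qed
  then have "fa_word w \<notin> ?T d" using incl by blast
  have "\<exists>s. stays_in (range d) s w"
  proof (rule ccontr)
    assume no: "\<not> ?thesis"
    have "eval_word \<tau> w = 0" if "\<forall>x. \<tau> x \<in> elementary_grading d (snd x)" for \<tau> :: "'g gvar \<Rightarrow> 'f^4^4"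
      using eval_word_elementary_entry[OF d, of \<tau>] that no by (simp add: vec_eq_iff)
    then show False using \<open>fa_word w \<notin> ?T d\<close> by (simp add: graded_identities_def)
  qed
  then obtain s where "stays_in (range d) s w" ..
  then have "\<forall>i. s - d' 0 + d' i \<in> range d"
    unfolding forall_idx4 by (simp add: w_def algebra_simps)
  then show ?thesis by blast
qed

section \<open>Increasing degree tuples described by their gaps\<close>

definition gap_tuple :: "'g::ab_group_add \<Rightarrow> 'g \<Rightarrow> 'g \<Rightarrow> 4 \<Rightarrow> 'g" where
  "gap_tuple x y z i = (if i = 0 then 0 else if i = 1 then x else if i = 2 then x + y else x + y + z)"

lemma gap_tuple_simps [simp]:
  "gap_tuple x y z 0 = 0" "gap_tuple x y z 1 = x" "gap_tuple x y z 2 = x + y" "gap_tuple x y z 3 = x + y + z"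
  by (simp_all add: gap_tuple_def)

lemma range_gap_tuple: "range (gap_tuple x y z) = {0, x, x + y, x + y + z}"
  by (simp add: range_idx4)

lemma inj_gap_tuple:
  fixes x y z :: "'g::linordered_ab_group_add"
  assumes "0 < x" "0 < y" "0 < z"
  shows "inj (gap_tuple x y z)"
proof -
  have "0 < x + y" "0 < y + z" "0 < x + y + z" using assms by (simp_all add: add_pos_pos)
  then have "\<forall>i j. gap_tuple x y z i = gap_tuple x y z j \<longrightarrow> i = j"
    unfolding forall_idx4 using assms by (auto simp: add.assoc)
  then show ?thesis by (auto simp: inj_def)
qed

lemma gap_tuple_differences_pos:
  fixes x y z :: "'g::linordered_ab_group_add"
  assumes "0 < x" "0 < y" "0 < z" and "gap_tuple x y z p \<le> gap_tuple x y z q"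
  shows "gap_tuple x y z q - gap_tuple x y z p \<in> {0, x, y, z, x + y, y + z, x + y + z}"
proof -
  have "0 < x + y" "0 < y + z" "0 < x + y + z" using assms by (simp_all add: add_pos_pos)
  then have "\<forall>q p. gap_tuple x y z p \<le> gap_tuple x y z q \<longrightarrow>
      gap_tuple x y z q - gap_tuple x y z p \<in> {0, x, y, z, x + y, y + z, x + y + z}"
    unfolding forall_idx4 using assms(1-3) by (auto simp: add.assoc)
  then show ?thesis using assms(4) by blast
qed

text \<open>Relative to its minimum \<open>m\<close>, \<open>S\<close> lies in {0, a, b, a+b, 2a+b},
  where only \<open>b\<close> can miss the tuple. If \<open>b\<close> is absent or equal to
  \<open>a\<close>, translate \<open>m\<close> to 0. If it is present, translate \<open>m\<close> to
  \<open>a\<close>: then \<open>a\<close> and \<open>2a+b\<close> must be absent.\<close>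

lemma symmetric_gaps_generated:
  fixes a b :: "'g::linordered_ab_group_add"
  assumes ab: "0 < a" "0 < b" "a \<noteq> b + b" "a + a \<noteq> b"
  shows "graded_identities (elementary_grading (gap_tuple a b a)) =
    TG_generated (gen_identities (elementary_grading (gap_tuple a b a) :: 'g \<Rightarrow> ('f::field_char_0^4^4) set))"
proof (rule graded_identities_generated)
  show "inj (gap_tuple a b a)" using ab by (intro inj_gap_tuple) auto
next
  fix S :: "'g set"
  assume S: "finite S" "S \<noteq> {}"
    and diff: "\<And>x y. x \<in> S \<Longrightarrow> y \<in> S \<Longrightarrow> \<exists>p q. y - x = gap_tuple a b a q - gap_tuple a b a p"
  let ?P = "{0, a, b, a + b, a + b + a}"
  have pos: "0 < a + b" "0 < a + b + a" "0 < a + a" "0 < b + b" "0 < a + a + a" "0 < a + b + b" "0 < b + a + b"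
    using ab by (simp_all add: add_pos_pos)
  have P: "y - x \<in> ?P" if xy: "x \<in> S" "y \<in> S" "x \<le> y" for x y
  proof -
    obtain p q where pq: "y - x = gap_tuple a b a q - gap_tuple a b a p" using diff xy by blast
    then have "gap_tuple a b a p \<le> gap_tuple a b a q" using xy by (metis diff_ge_0_iff_ge)
    then show ?thesis
      using gap_tuple_differences_pos[OF ab(1) ab(2) ab(1), of p q]
      unfolding pq by (simp only: insert_iff empty_iff add.commute[of b a]) blast
  qed
  define m where "m = Min S"
  have m: "m \<in> S" "\<And>x. x \<in> S \<Longrightarrow> m \<le> x" using S by (auto simp: m_def)
  have Pm: "x - m \<in> ?P" if "x \<in> S" for x using P m that by blast
  show "\<exists>t. \<forall>x\<in>S. t + x \<in> range (gap_tuple a b a)"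
  proof (cases "a \<noteq> b \<and> m + b \<in> S")
    case False
    then have "x - m \<noteq> b \<or> a = b" if "x \<in> S" for x using that by (auto simp: algebra_simps)
    then have "x - m \<in> {0, a, a + b, a + b + a}" if "x \<in> S" for x using Pm[OF that] that by auto
    then show ?thesis unfolding range_gap_tuple by (intro exI[of _ "- m"]) simp
  next
    case True
    \<comment> \<open>If \<open>a\<close> and \<open>b\<close> both occurred, their difference would
      lie in the support, which leaves only \<open>b = 2a\<close> or \<open>a = 2b\<close>.\<close>
    have "x - m \<noteq> a" if x: "x \<in> S" for x
    proof
      assume xm: "x - m = a"
      then have e: "x = m + a" by (simp add: algebra_simps)
      show False
      proof (cases "a \<le> b")
        case True
        then have "x \<le> m + b" by (simp add: e)
        then have "(m + b) - x \<in> ?P" using P[OF x] \<open>a \<noteq> b \<and> m + b \<in> S\<close> by blast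
        moreover have "(m + b) - x = b - a" by (simp add: e)
        ultimately have "b - a \<in> ?P" by metis
        then show False using ab \<open>a \<noteq> b \<and> m + b \<in> S\<close> pos by (auto simp: diff_eq_eq add.assoc)
      next
        case False
        then have "m + b \<le> x" by (simp add: e)
        then have "x - (m + b) \<in> ?P" using P[OF _ x] \<open>a \<noteq> b \<and> m + b \<in> S\<close> by blast
        moreover have "x - (m + b) = a - b" by (simp add: e)
        ultimately have "a - b \<in> ?P" by metis
        then show False using ab \<open>a \<noteq> b \<and> m + b \<in> S\<close> pos by (auto simp: diff_eq_eq add.assoc)
      qed
    qed
    \<comment> \<open>The difference to \<open>m + b\<close> is \<open>a + a\<close>, which by
      positivity could only be \<open>b\<close> or \<open>a + b\<close>; both are excluded.\<close>
    moreover have "x - m \<noteq> a + b + a" if x: "x \<in> S" for x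
    proof
      assume "x - m = a + b + a"
      then have e: "x = m + b + (a + a)" by (simp add: algebra_simps)
      then have "m + b \<le> x" using pos by simp
      then have "x - (m + b) \<in> ?P" using P[OF _ x] True by blast
      moreover have "x - (m + b) = a + a" by (simp add: e)
      ultimately have "a + a \<in> ?P" by metis
      then show False using ab True pos by (auto simp: diff_eq_eq add.assoc)
    qed
    ultimately have "x - m \<in> {0, b, a + b}" if "x \<in> S" for x using Pm[OF that] that by auto
    then have "(a - m) + x \<in> {a, a + b, a + b + a}" if "x \<in> S" for x
      using that by (fastforce simp: algebra_simps)
    then show ?thesis unfolding range_gap_tuple by (intro exI[of _ "a - m"]) blast
  qed
qed

text \<open>\<open>translate_if_generated\<close> is applied to three test tuples: the negatives of
  the tuple itself, and arithmetic progressions of step \<open>y\<close> or \<open>x\<close> in the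
  two degenerate cases.\<close>

lemma gaps_if_generated:
  fixes x y z :: "'g::linordered_ab_group_add"
  assumes pos: "0 < x" "0 < y" "0 < z"
    and gen: "graded_identities (elementary_grading (gap_tuple x y z)) =
      TG_generated (gen_identities (elementary_grading (gap_tuple x y z) :: 'g \<Rightarrow> ('f::field^4^4) set))"
  shows "x = z \<and> x \<noteq> y + y \<and> x + x \<noteq> y"
proof -
  let ?d = "gap_tuple x y z"
  have inj: "inj ?d" using pos by (rule inj_gap_tuple)
  have xz: "x = z"
  proof -
    have "\<exists>t. \<forall>i. t + (- ?d i) \<in> range ?d"
    proof (rule translate_if_generated[OF inj _ gen])
      show "inj (\<lambda>i. - ?d i)" using inj unfolding inj_def neg_equal_iff_equal .
      show "\<exists>p' q'. - ?d q - - ?d p = ?d q' - ?d p'" for p q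
        by (intro exI[of _ q] exI[of _ p]) simp
    qed
    then obtain t where "\<forall>i. t + (- ?d i) \<in> range ?d" ..
    then have t: "t \<in> range ?d" "t - x \<in> range ?d" "t - (x + y) \<in> range ?d" "t - (x + y + z) \<in> range ?d"
      by (simp_all only: forall_idx4 gap_tuple_simps add_uminus_conv_diff diff_zero)
    have sums: "0 < x + y" "0 < y + z" "0 < x + y + z" using pos by (simp_all add: add_pos_pos)
    \<comment> \<open>Both sets have the same width, so the translation must match their extreme
      elements.\<close>
    have "t \<le> x + y + z" using t(1) pos sums unfolding range_gap_tuple by (auto simp: add.assoc less_imp_le)
    moreover have "0 \<le> t - (x + y + z)" using t(4) pos sums unfolding range_gap_tuple
      by (auto simp: less_imp_le simp del: diff_ge_0_iff_ge)
    ultimately have tt: "t = x + y + z" by simp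
    have "y + z \<in> {0, x, x + y, x + y + z}" "z \<in> {0, x, x + y, x + y + z}"
      using t(2,3) unfolding tt range_gap_tuple by (simp_all add: algebra_simps)
    then show ?thesis using pos sums by (auto simp: algebra_simps)
  qed
  \<comment> \<open>The two shapes come from the gaps (2u, u, 2u) and (u, 2u, u). Neither contains
    \<open>t\<close>, \<open>t + u\<close> and \<open>t + 2u\<close> at once.\<close>
  have arith: False if y: "0 < (u::'g)" and tr: "\<exists>t. \<forall>i. t + gap_tuple u u u i \<in> range ?d"
    and d: "range ?d = {0, u + u, u + u + u, u + u + u + u + u} \<or> range ?d = {0, u, u + u + u, u + u + u + u}" for u
  proof -
    obtain t where t: "\<forall>i. t + gap_tuple u u u i \<in> range ?d" using tr ..
    then have t: "t \<in> range ?d" "t + u \<in> range ?d" "t + (u + u) \<in> range ?d" "t + (u + u + u) \<in> range ?d"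
      unfolding forall_idx4 gap_tuple_simps by simp_all
    have pos: "0 < u + u" "0 < u + (u + u)" "0 < u + (u + (u + u))" "0 < u + (u + (u + (u + u)))"
      "0 < u + (u + (u + (u + (u + u))))" "0 < u + (u + (u + (u + (u + (u + u)))))"
      using y by (simp_all add: add_pos_pos)
    from d show False
    proof
      assume d: "range ?d = {0, u + u, u + u + u, u + u + u + u + u}"
      have "t = 0 \<or> t = u + u \<or> t = u + u + u \<or> t = u + u + u + u + u" using t(1) unfolding d by blast
      then show False using t(2,3) y pos unfolding d by (elim disjE) (auto simp: add.assoc)
    next
      assume d: "range ?d = {0, u, u + u + u, u + u + u + u}"
      have "t = 0 \<or> t = u \<or> t = u + u + u \<or> t = u + u + u + u" using t(1) unfolding d by blast
      then show False using t(2,3) y pos unfolding d by (elim disjE) (auto simp: add.assoc)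
    qed
  qed
  have inj': "inj (gap_tuple u u u)" if "0 < u" for u :: 'g using that that that by (rule inj_gap_tuple)
  have diffs: "\<forall>q p. \<exists>p' q'. gap_tuple u u u q - gap_tuple u u u p = ?d q' - ?d p'"
    if ex: "\<exists>p' q'. u = ?d q' - ?d p'" "\<exists>p' q'. u + u = ?d q' - ?d p'" "\<exists>p' q'. u + u + u = ?d q' - ?d p'" for u
  proof -
    define E where "E v \<longleftrightarrow> (\<exists>p' q'. v = ?d q' - ?d p')" for v
    have neg: "E (- v)" if "E v" for v using that unfolding E_def by (metis minus_diff_eq)
    have "E 0" unfolding E_def by (metis diff_self)
    moreover have "E u" "E (u + u)" "E (u + u + u)" using ex by (simp_all add: E_def)
    moreover from this have "E (- u)" "E (- u - u)" "E (- u - u - u)"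
      using neg[of u] neg[of "u + u"] neg[of "u + u + u"] by simp_all
    ultimately have "\<forall>q p. E (gap_tuple u u u q - gap_tuple u u u p)" unfolding forall_idx4 by simp
    then show ?thesis by (simp add: E_def)
  qed
  have "x \<noteq> y + y"
  proof
    assume x: "x = y + y"
    have "\<forall>q p. \<exists>p' q'. gap_tuple y y y q - gap_tuple y y y p = ?d q' - ?d p'"
    proof (rule diffs)
      show "\<exists>p' q'. y = ?d q' - ?d p'" by (intro exI[of _ 1] exI[of _ 2]) simp
      show "\<exists>p' q'. y + y = ?d q' - ?d p'" by (intro exI[of _ 0] exI[of _ 1]) (simp add: x)
      show "\<exists>p' q'. y + y + y = ?d q' - ?d p'" by (intro exI[of _ 0] exI[of _ 2]) (simp add: x)
    qed
    then have "\<exists>t. \<forall>i. t + gap_tuple y y y i \<in> range ?d"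
      by (intro translate_if_generated[OF inj inj'[OF pos(2)] gen]) blast
    then show False by (rule arith[OF pos(2)]) (simp add: range_gap_tuple x xz[symmetric] algebra_simps)
  qed
  moreover have "x + x \<noteq> y"
  proof
    assume y: "x + x = y"
    have "\<forall>q p. \<exists>p' q'. gap_tuple x x x q - gap_tuple x x x p = ?d q' - ?d p'"
    proof (rule diffs)
      show "\<exists>p' q'. x = ?d q' - ?d p'" by (intro exI[of _ 0] exI[of _ 1]) simp
      show "\<exists>p' q'. x + x = ?d q' - ?d p'" by (intro exI[of _ 1] exI[of _ 2]) (simp add: y)
      show "\<exists>p' q'. x + x + x = ?d q' - ?d p'" by (intro exI[of _ 0] exI[of _ 2]) (simp add: y[symmetric] add.assoc)
    qed
    then have "\<exists>t. \<forall>i. t + gap_tuple x x x i \<in> range ?d"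
      by (intro translate_if_generated[OF inj inj'[OF pos(1)] gen]) blast
    then show False by (rule arith[OF pos(1)]) (simp add: range_gap_tuple y[symmetric] xz[symmetric] algebra_simps)
  qed
  ultimately show ?thesis using xz by blast
qed

section \<open>Isomorphic gradings\<close>

lemma alg_iso_zero: "alg_iso \<phi> \<Longrightarrow> \<phi> 0 = 0"
  unfolding alg_iso_def by (metis add_cancel_right_right)

lemma alg_iso_sum: "alg_iso \<phi> \<Longrightarrow> \<phi> (sum f S) = (\<Sum>x\<in>S. \<phi> (f x))"
  by (induction S rule: infinite_finite_induct) (auto simp: alg_iso_zero, auto simp: alg_iso_def)

lemma alg_iso_one:
  assumes "alg_iso \<phi>" shows "\<phi> (mat 1) = mat 1"
proof -
  obtain M where "\<phi> M = mat 1" using assms unfolding alg_iso_def by (metis bij_pointE)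
  moreover have "\<phi> (mat 1 ** M) = \<phi> (mat 1) ** \<phi> M" using assms unfolding alg_iso_def by blast
  ultimately show ?thesis by simp
qed

lemma alg_iso_inv:
  assumes "alg_iso \<phi>" shows "alg_iso (inv \<phi>)"
proof -
  have bij: "bij \<phi>" using assms by (simp add: alg_iso_def)
  have e: "inv \<phi> y = x \<longleftrightarrow> y = \<phi> x" for x y using bij by (metis bij_inv_eq_iff)
  have r: "\<phi> (inv \<phi> y) = y" for y using bij by (simp add: bij_is_surj surj_f_inv_f)
  show ?thesis using assms bij bij_imp_bij_inv[OF bij] unfolding alg_iso_def e by (simp add: r)
qed

lemma iso_gradings_sym: "iso_gradings A B \<Longrightarrow> iso_gradings B A"
proof -
  assume "iso_gradings A B"
  then obtain \<phi> where \<phi>: "alg_iso \<phi>" "\<And>g. \<phi> ` A g = B g" by (auto simp: iso_gradings_def)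
  have "inv \<phi> ` B g = A g" for g
    using \<phi>(1) unfolding \<phi>(2)[symmetric] alg_iso_def by (simp add: image_inv_f_f bij_is_inj)
  then show ?thesis using alg_iso_inv[OF \<phi>(1)] by (auto simp: iso_gradings_def)
qed

lemma iso_gradings_trans: "iso_gradings A B \<Longrightarrow> iso_gradings B C \<Longrightarrow> iso_gradings A C"
proof -
  assume "iso_gradings A B" "iso_gradings B C"
  then obtain \<phi> \<psi> where \<phi>: "alg_iso \<phi>" "\<And>g. \<phi> ` A g = B g" and \<psi>: "alg_iso \<psi>" "\<And>g. \<psi> ` B g = C g"
    unfolding iso_gradings_def by metis
  have "alg_iso (\<psi> \<circ> \<phi>)" using \<phi>(1) \<psi>(1) unfolding alg_iso_def by (auto intro: bij_comp)
  moreover have "(\<psi> \<circ> \<phi>) ` A g = C g" for g using \<phi>(2) \<psi>(2) by (metis image_comp)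
  ultimately show ?thesis unfolding iso_gradings_def by blast
qed

lemma eval_fa_alg_iso:
  assumes "alg_iso \<phi>"
  shows "eval_fa (\<lambda>x. \<phi> (\<sigma> x)) p = \<phi> (eval_fa \<sigma> p)"
proof -
  have "eval_word (\<lambda>x. \<phi> (\<sigma> x)) w = \<phi> (eval_word \<sigma> w)" for w
    using assms by (induction w) (auto simp: alg_iso_one, auto simp: alg_iso_def)
  then show ?thesis unfolding eval_fa_def alg_iso_sum[OF assms] using assms by (simp add: alg_iso_def)
qed

lemma graded_identities_iso_subset:
  assumes "iso_gradings A B" shows "graded_identities B \<subseteq> graded_identities A"
proof
  fix p assume p: "p \<in> graded_identities B"
  obtain \<phi> where \<phi>: "alg_iso \<phi>" "\<And>g. \<phi> ` A g = B g" using assms by (auto simp: iso_gradings_def)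
  have "eval_fa \<sigma> p = 0" if "\<forall>x. \<sigma> x \<in> A (snd x)" for \<sigma>
  proof -
    have "\<forall>x. \<phi> (\<sigma> x) \<in> B (snd x)" using that \<phi>(2) by blast
    then have "\<phi> (eval_fa \<sigma> p) = \<phi> 0"
      using p by (simp add: graded_identities_def eval_fa_alg_iso[OF \<phi>(1), symmetric] alg_iso_zero[OF \<phi>(1)])
    then show ?thesis using \<phi>(1) by (auto simp: alg_iso_def bij_def dest: injD)
  qed
  then show "p \<in> graded_identities A" using p by (simp add: graded_identities_def)
qed

lemma graded_identities_iso: "iso_gradings A B \<Longrightarrow> graded_identities A = graded_identities B"
  by (rule equalityI) (erule graded_identities_iso_subset[OF iso_gradings_sym], erule graded_identities_iso_subset)

text \<open>The generators depend on a grading only through its support, which an isomorphism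
  preserves.\<close>

lemma gen_identities_iso:
  assumes "iso_gradings A B" shows "gen_identities A = gen_identities B"
proof -
  obtain \<phi> where \<phi>: "alg_iso \<phi>" "\<And>g. \<phi> ` A g = B g" using assms by (auto simp: iso_gradings_def)
  have "inj \<phi>" using \<phi>(1) by (simp add: alg_iso_def bij_is_inj)
  then have "A g = {0} \<longleftrightarrow> B g = {0}" for g
    unfolding \<phi>(2)[symmetric] using inj_image_eq_iff[of \<phi> "A g" "{0}"] by (simp add: alg_iso_zero[OF \<phi>(1)])
  then show ?thesis unfolding gen_identities_def by simp
qed

text \<open>Conjugation by a permutation matrix renames the indices, and a common shift leaves all
  degree differences unchanged.\<close>

lemma iso_elementary_grading_reindex:
  fixes d d' :: "'n::finite \<Rightarrow> 'g::ab_group_add"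
  assumes \<pi>: "bij \<pi>" and d': "\<And>i. d (\<pi> i) = d' i + c"
  shows "iso_gradings (elementary_grading d :: 'g \<Rightarrow> ('f::field^'n^'n) set) (elementary_grading d')"
proof -
  define \<phi> :: "'f^'n^'n \<Rightarrow> 'f^'n^'n" where "\<phi> M = (\<chi> i j. M $ \<pi> i $ \<pi> j)" for M
  define \<psi> :: "'f^'n^'n \<Rightarrow> 'f^'n^'n" where "\<psi> M = (\<chi> i j. M $ inv \<pi> i $ inv \<pi> j)" for M
  have r: "\<pi> (inv \<pi> i) = i" "inv \<pi> (\<pi> i) = i" for i
    using \<pi> by (simp_all add: bij_is_surj surj_f_inv_f bij_is_inj)
  have \<phi>\<psi>: "\<phi> (\<psi> M) = M" "\<psi> (\<phi> M) = M" for M by (simp_all add: \<phi>_def \<psi>_def r vec_eq_iff)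
  have "\<phi> (M ** N) = \<phi> M ** \<phi> N" for M N
    using sum.reindex_bij_betw[OF \<pi>, of "\<lambda>k. M $ \<pi> i $ k * N $ k $ \<pi> j" for i j]
    by (simp only: \<phi>_def matrix_matrix_mult_def vec_eq_iff vec_lambda_beta) simp
  moreover have "bij \<phi>" using \<phi>\<psi> by (intro o_bij[of \<psi>]) auto
  ultimately have "alg_iso \<phi>" by (simp add: alg_iso_def) (simp add: \<phi>_def vec_eq_iff)
  moreover have "\<phi> ` elementary_grading d g = elementary_grading d' g" for g
  proof
    show "\<phi> ` elementary_grading d g \<subseteq> elementary_grading d' g"
      unfolding elementary_grading_def using d' by (auto simp: \<phi>_def) (metis add_diff_cancel_right)
    show "elementary_grading d' g \<subseteq> \<phi> ` elementary_grading d g"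
    proof
      fix M :: "'f^'n^'n" assume M: "M \<in> elementary_grading d' g"
      have "d q - d p = g" if "\<psi> M $ p $ q \<noteq> 0" for p q
        using that M d'[of "inv \<pi> p"] d'[of "inv \<pi> q"] by (auto simp: \<psi>_def elementary_grading_def r)
      then have "\<psi> M \<in> elementary_grading d g" by (simp add: elementary_grading_def)
      then show "M \<in> \<phi> ` elementary_grading d g" using \<phi>\<psi>(1) by (metis imageI)
    qed
  qed
  ultimately show ?thesis unfolding iso_gradings_def by blast
qed

text \<open>If \<open>d i = d j\<close> with \<open>i \<noteq> j\<close>, the matrix units at (i, j)
  and (j, i) both have degree 0 and do not commute.\<close>

lemma inj_if_neutral_component_commutative:
  fixes d :: "'n::finite \<Rightarrow> 'g::ab_group_add"
  assumes comm: "\<And>x y. x \<in> elementary_grading d 0 \<Longrightarrow> y \<in> elementary_grading d 0 \<Longrightarrow> x ** y = y ** (x :: 'f::field^'n^'n)"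
  shows "inj d"
proof (rule injI, rule ccontr)
  fix i j assume ij: "d i = d j" "i \<noteq> j"
  define M :: "'f^'n^'n" where "M = (\<chi> k l. if k = i \<and> l = j then 1 else 0)"
  define N :: "'f^'n^'n" where "N = (\<chi> k l. if k = j \<and> l = i then 1 else 0)"
  have "M ** N = N ** M" using ij by (intro comm) (auto simp: M_def N_def elementary_grading_def)
  then have "(M ** N) $ i $ i = (N ** M) $ i $ i" by simp
  moreover have "(M ** N) $ i $ i = (\<Sum>k\<in>UNIV. if k = j then 1 else 0)"
    unfolding matrix_matrix_mult_def vec_lambda_beta by (intro sum.cong) (auto simp: M_def N_def)
  moreover have "(N ** M) $ i $ i = 0"
    using ij(2) by (simp add: matrix_matrix_mult_def N_def)
  ultimately show False by simp
qed

lemma card_4_sorted: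
  fixes D :: "'a::linorder set"
  assumes "card D = 4"
  obtains e0 e1 e2 e3 where "D = {e0, e1, e2, e3}" "e0 < e1" "e1 < e2" "e2 < e3"
proof -
  have fin: "finite D" using assms by (metis card.infinite zero_neq_numeral)
  define l where "l = sorted_list_of_set D"
  have "length l = Suc (Suc (Suc (Suc 0)))" using assms by (simp add: l_def)
  then obtain e0 e1 e2 e3 where e: "l = [e0, e1, e2, e3]" by (auto simp: length_Suc_conv)
  then have l: "sorted_list_of_set D = [e0, e1, e2, e3]" by (simp add: l_def)
  have "sorted_wrt (<) (sorted_list_of_set D)" by (rule strict_sorted_list_of_set)
  then show ?thesis using that[of e0 e1 e2 e3] set_sorted_list_of_set[OF fin] unfolding l by auto
qed

lemma elementary_grading_iso_gap_tuple:
  fixes d :: "4 \<Rightarrow> 'g::linordered_ab_group_add"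
  assumes "inj d"
  obtains x y z where "0 < x" "0 < y" "0 < z"
    "iso_gradings (elementary_grading d :: 'g \<Rightarrow> ('f::field^4^4) set) (elementary_grading (gap_tuple x y z))"
proof -
  have "card (range d) = 4" using assms by (simp add: card_image)
  then obtain e0 e1 e2 e3 where e: "range d = {e0, e1, e2, e3}" "e0 < e1" "e1 < e2" "e2 < e3"
    by (rule card_4_sorted)
  let ?x = "e1 - e0" and ?y = "e2 - e1" and ?z = "e3 - e2"
  have pos: "0 < ?x" "0 < ?y" "0 < ?z" using e by auto
  define \<pi> where "\<pi> i = inv d (gap_tuple ?x ?y ?z i + e0)" for i
  have "\<forall>i. gap_tuple ?x ?y ?z i + e0 \<in> range d" unfolding forall_idx4 e(1) by simp
  then have d\<pi>: "d (\<pi> i) = gap_tuple ?x ?y ?z i + e0" for i by (simp add: \<pi>_def f_inv_into_f)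
  have "inj \<pi>" using inj_gap_tuple[OF pos] d\<pi> unfolding inj_def by (metis add_right_cancel)
  then have "bij \<pi>" by (simp add: bij_def finite_UNIV_inj_surj)
  then have "iso_gradings (elementary_grading d :: 'g \<Rightarrow> ('f^4^4) set) (elementary_grading (gap_tuple ?x ?y ?z))"
    by (rule iso_elementary_grading_reindex[of _ d _ e0]) (rule d\<pi>)
  with pos show ?thesis by (rule that)
qed

lemma gap_tuple_symmetric:
  "gap_tuple a b a = (\<lambda>i::4. if i = 0 then 0 else if i = 1 then a else if i = 2 then a + b else a + a + b)"
  by (auto simp: gap_tuple_def add_ac)

section \<open>Gradings of matrix algebras by ordered groups are elementary\<close>

lemma msmult_vector: "msmult c M *v v = c *s (M *v v)"
  for c :: "'f::field" and M :: "'f^'n::finite^'n" 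
  by (simp add: vec_eq_iff matrix_vector_mult_def sum_distrib_left mult.assoc)

lemma matrix_vector_mult_sum: "sum f S *v v = (\<Sum>x\<in>S. f x *v v)"
  for f :: "'b \<Rightarrow> 'f::field^'n::finite^'n"
  by (induction S rule: infinite_finite_induct) (simp_all add: matrix_vector_mult_add_rdistrib)

text \<open>The vector \<open>p(z) v\<close>, computed by Horner's scheme without forming the matrix
  \<open>p(z)\<close>.\<close>

definition poly_act :: "'f::field^'n^'n \<Rightarrow> 'f^'n::finite \<Rightarrow> 'f poly \<Rightarrow> 'f^'n" where
  "poly_act z v p = fold_coeffs (\<lambda>a y. a *s v + z *v y) p 0"

lemma poly_act_0 [simp]: "poly_act z v 0 = 0"
  by (simp add: poly_act_def)

lemma poly_act_pCons [simp]: "poly_act z v (pCons a p) = a *s v + z *v poly_act z v p"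
  by (cases "p = 0 \<and> a = 0") (auto simp: poly_act_def)

lemma poly_act_add: "poly_act z v (p + q) = poly_act z v p + poly_act z v q"
  by (induction p q rule: poly_induct2)
    (simp_all add: matrix_vector_right_distrib vec.scale_left_distrib algebra_simps)

lemma poly_act_smult: "poly_act z v (smult c p) = c *s poly_act z v p"
  by (induction p) (simp_all add: vec.scale_right_distrib vector_scalar_commute)

lemma poly_act_sum: "poly_act z v (\<Sum>x\<in>S. f x) = (\<Sum>x\<in>S. poly_act z v (f x))"
  by (induction S rule: infinite_finite_induct) (simp_all add: poly_act_add)

text \<open>The n + 1 vectors obtained from \<open>w\<close> by powers of \<open>z\<close> are
  linearly dependent. A coincidence among them is treated separately, since dependence is a property
  of sets.\<close>

lemma poly_act_annihilator_exists:
  fixes z :: "'f::field^'n::finite^'n"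
  shows "\<exists>p. p \<noteq> 0 \<and> poly_act z w p = 0"
proof -
  let ?n = "CARD('n)"
  let ?w = "\<lambda>k. poly_act z w (monom 1 k)"
  show ?thesis
  proof (cases "inj_on ?w {..?n}")
    case False
    then obtain i j where ij: "i \<noteq> j" "?w i = ?w j" by (auto simp: inj_on_def)
    have "poly_act z w (monom 1 i + smult (- 1) (monom 1 j)) = 0"
      unfolding poly_act_add poly_act_smult ij(2) by (simp add: vec_eq_iff)
    moreover have "coeff (monom 1 i + smult (- 1) (monom 1 j)) i \<noteq> (0 :: 'f)" using ij(1) by simp
    ultimately show ?thesis by (metis coeff_0)
  next
    case True
    let ?B = "?w ` {..?n}"
    have card: "card ?B = Suc ?n" using True by (simp add: card_image)
    have "vec.dependent ?B"
    proof (rule ccontr)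
      assume "vec.independent ?B"
      then have "card ?B \<le> vec.dim (UNIV :: ('f^'n) set)"
        by (intro vec.independent_card_le_dim) auto
      then show False using card by (simp only: vec_dim_card)
    qed
    then obtain u v where v: "v \<in> ?B" "u v \<noteq> 0" and s: "(\<Sum>v\<in>?B. u v *s v) = 0"
      by (auto simp: vec.dependent_finite)
    obtain k where k: "k \<le> ?n" "v = ?w k" using v(1) by auto
    let ?p = "\<Sum>i\<le>?n. smult (u (?w i)) (monom 1 i)"
    have "poly_act z w ?p = (\<Sum>v\<in>?B. u v *s v)"
      using True by (simp add: poly_act_sum poly_act_smult sum.reindex del: smult_monom)
    moreover have "coeff ?p k \<noteq> 0" using v(2) k by (simp add: coeff_sum if_distrib cong: if_cong)
    ultimately show ?thesis using s by (metis coeff_0)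
  qed
qed

text \<open>Take \<open>p\<close> of least degree annihilating \<open>w\<close> and split off a root
  \<open>c\<close>. The cofactor \<open>q\<close> does not annihilate \<open>w\<close>, so
  \<open>q(z) w\<close> is an eigenvector; it stays in \<open>S\<close> by invariance.\<close>

lemma eigenvector_in_invariant_subspace:
  fixes z :: "'f::field^'n::finite^'n"
  assumes ac: "alg_closed TYPE('f)" and S: "vec.subspace S"
    and inv: "\<And>v. v \<in> S \<Longrightarrow> z *v v \<in> S" and w: "w \<in> S" "w \<noteq> 0"
  obtains v c where "v \<in> S" "v \<noteq> 0" "z *v v = c *s v"
proof -
  obtain p where p: "p \<noteq> 0" "poly_act z w p = 0"
    and min: "\<And>q. q \<noteq> 0 \<Longrightarrow> poly_act z w q = 0 \<Longrightarrow> degree p \<le> degree q"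
    using ex_has_least_nat[of "\<lambda>p. p \<noteq> 0 \<and> poly_act z w p = 0" _ degree]
      poly_act_annihilator_exists[of z w] by metis
  have "0 < degree p"
  proof (rule ccontr)
    assume "\<not> 0 < degree p"
    then obtain c where "p = [:c:]" by (metis degree_eq_zeroE neq0_conv)
    then show False using p w by (simp add: vec.scale_eq_0_iff)
  qed
  then obtain c where "poly p c = 0" using ac by (auto simp: alg_closed_def)
  then obtain q where q: "p = [:- c, 1:] * q" by (auto simp: poly_eq_0_iff_dvd)
  then have "q \<noteq> 0" using p by auto
  have "degree q < degree p" using \<open>q \<noteq> 0\<close> by (simp add: q degree_mult_eq del: mult_pCons_left)
  then have v: "poly_act z w q \<noteq> 0" using min[of q] \<open>q \<noteq> 0\<close> by force
  have "p = smult (- c) q + pCons 0 q" by (simp add: q)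
  then have "poly_act z w (smult (- c) q + pCons 0 q) = 0" using p(2) by (simp only:)
  then have "(- c) *s poly_act z w q + (0 *s w + z *v poly_act z w q) = 0"
    by (simp only: poly_act_add poly_act_smult poly_act_pCons)
  then have "z *v poly_act z w q = c *s poly_act z w q"
    by (simp add: vec_eq_iff add_eq_0_iff)
  moreover have "poly_act z w q \<in> S"
    using w(1) by (induction q) (auto intro: vec.subspace_add[OF S] vec.subspace_scale[OF S] vec.subspace_0[OF S] inv)
  ultimately show ?thesis using that v by blast
qed

section \<open>Components of an arbitrary grading\<close>

lemma gradingD:
  assumes "is_grading A"
  shows "0 \<in> A g" "x \<in> A g \<Longrightarrow> y \<in> A g \<Longrightarrow> x + y \<in> A g" "x \<in> A g \<Longrightarrow> msmult c x \<in> A g"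
    "x \<in> A g \<Longrightarrow> y \<in> A h \<Longrightarrow> x ** y \<in> A (g + h)"
proof -
  have sub: "mat_subspace (A g)" and mult: "\<forall>g h. \<forall>x\<in>A g. \<forall>y\<in>A h. x ** y \<in> A (g + h)"
    using assms unfolding is_grading_def by simp_all
  show "0 \<in> A g" "x \<in> A g \<Longrightarrow> y \<in> A g \<Longrightarrow> x + y \<in> A g" "x \<in> A g \<Longrightarrow> msmult c x \<in> A g"
    using sub by (simp_all add: mat_subspace_def)
  show "x \<in> A g \<Longrightarrow> y \<in> A h \<Longrightarrow> x ** y \<in> A (g + h)" using mult by simp
qed

lemma grading_diff: "is_grading A \<Longrightarrow> x \<in> A g \<Longrightarrow> y \<in> A g \<Longrightarrow> x - y \<in> A g"
proof -
  assume A: "is_grading A" "x \<in> A g" "y \<in> A g"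
  have "x + msmult (- 1) y \<in> A g" using gradingD[OF A(1)] A by blast
  moreover have "msmult (- 1) y = - y" by (simp add: vec_eq_iff)
  ultimately show ?thesis by simp
qed

lemma grading_sum: "is_grading A \<Longrightarrow> (\<And>i. i \<in> S \<Longrightarrow> f i \<in> A g) \<Longrightarrow> sum f S \<in> A g"
  by (induction S rule: infinite_finite_induct) (auto intro: gradingD)

lemma grading_decompose:
  assumes "is_grading A"
  obtains c where "finite {g. c g \<noteq> 0}" "\<And>g. c g \<in> A g" "M = sum c {g. c g \<noteq> 0}"
  using assms unfolding is_grading_def by metis

lemma grading_independent:
  assumes A: "is_grading A" and T: "finite T" and c: "\<And>g. g \<in> T \<Longrightarrow> c g \<in> A g" and z: "sum c T = 0" and g: "g \<in> T"
  shows "c g = 0"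
proof -
  define c' where "c' g = (if g \<in> T then c g else 0)" for g
  have sub: "{g. c' g \<noteq> 0} \<subseteq> T" by (auto simp: c'_def)
  have "sum c' {g. c' g \<noteq> 0} = sum c' T" using T sub by (intro sum.mono_neutral_left) auto
  also have "\<dots> = 0" using z by (simp add: c'_def)
  finally have "sum c' {g. c' g \<noteq> 0} = 0" .
  moreover have "finite {g. c' g \<noteq> 0}" using sub T finite_subset by blast
  moreover have "\<forall>g. c' g \<in> A g" using c gradingD(1)[OF A] by (auto simp: c'_def)
  ultimately have "\<forall>g. c' g = 0" using A unfolding is_grading_def by blast
  then have "c' g = 0" ..
  then show ?thesis using g by (simp add: c'_def)
qed

text \<open>Only finitely many degrees \<open>T\<close> occur in the components of the matrix units,
  and these components span the whole algebra; an element of a degree outside \<open>T\<close>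
  contradicts directness of the sum.\<close>

lemma grading_finite_support:
  fixes A :: "'g::comm_monoid_add \<Rightarrow> ('f::field^'n::finite^'n) set"
  assumes A: "is_grading A"
  shows "finite {g. A g \<noteq> {0}}"
proof -
  define E :: "'n \<times> 'n \<Rightarrow> 'f^'n^'n" where "E ij = (\<chi> k l. if k = fst ij \<and> l = snd ij then 1 else 0)" for ij
  have "\<forall>ij. \<exists>c. finite {g. c g \<noteq> 0} \<and> (\<forall>g. c g \<in> A g) \<and> E ij = sum c {g. c g \<noteq> 0}"
    using A unfolding is_grading_def by blast
  then obtain c where c: "\<And>ij. finite {g. c ij g \<noteq> 0}" "\<And>ij g. c ij g \<in> A g"
    "\<And>ij. E ij = sum (c ij) {g. c ij g \<noteq> 0}" by metis
  define T where "T = (\<Union>ij. {g. c ij g \<noteq> 0})"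
  have finT: "finite T" using c(1) by (simp add: T_def)
  have ET: "E ij = sum (c ij) T" for ij
    unfolding c(3)[of ij] using finT by (intro sum.mono_neutral_left) (auto simp: T_def)
  have "A g = {0}" if g: "g \<notin> T" for g
  proof -
    have "x = 0" if x: "x \<in> A g" for x
    proof -
      \<comment> \<open>The relation \<open>x\<close> = (components in degrees of \<open>T\<close>),
        brought to one side: \<open>- x\<close> sits in degree \<open>g\<close>.\<close>
      define b where "b h = (if h = g then - x else \<Sum>ij\<in>UNIV. msmult (x $ fst ij $ snd ij) (c ij h))" for h
      have "x = (\<Sum>ij\<in>UNIV. msmult (x $ fst ij $ snd ij) (E ij))"
      proof -
        have "(\<Sum>ij\<in>UNIV. x $ fst ij $ snd ij * E ij $ k $ l) = x $ k $ l" for k l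
        proof -
          have "(\<Sum>ij\<in>UNIV. x $ fst ij $ snd ij * E ij $ k $ l) = (\<Sum>ij\<in>{(k,l)}. x $ fst ij $ snd ij * E ij $ k $ l)"
            by (intro sum.mono_neutral_right) (auto simp: E_def)
          then show ?thesis by (simp add: E_def)
        qed
        then show ?thesis by (simp add: vec_eq_iff)
      qed
      also have "\<dots> = (\<Sum>h\<in>T. \<Sum>ij\<in>UNIV. msmult (x $ fst ij $ snd ij) (c ij h))"
        unfolding ET msmult_sum_right by (rule sum.swap)
      also have "\<dots> = sum b T" using g by (intro sum.cong) (auto simp: b_def)
      finally have s0: "sum b (insert g T) = 0" using g finT by (simp add: b_def)
      have bA: "b h \<in> A h" for h
      proof (cases "h = g")
        case True
        then show ?thesis using grading_diff[OF A gradingD(1)[OF A] x] by (simp add: b_def)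
      next
        case False
        have "(\<Sum>ij\<in>UNIV. msmult (x $ fst ij $ snd ij) (c ij h)) \<in> A h"
          by (intro grading_sum[OF A] gradingD(3)[OF A] c(2))
        then show ?thesis using False by (simp add: b_def)
      qed
      have "b g = 0" by (rule grading_independent[where c = b, OF A _ bA s0]) (simp_all add: finT)
      then show ?thesis by (simp add: b_def)
    qed
    then show ?thesis using gradingD(1)[OF A] by blast
  qed
  then have "{g. A g \<noteq> {0}} \<subseteq> T" by blast
  then show ?thesis using finT finite_subset by blast
qed

text \<open>The hypothesis says that \<open>x\<close> and its square have the same kernel, so a
  nonzero \<open>x\<close> would have only nonzero powers. Their degrees are distinct multiples of
  \<open>g\<close> in an ordered group, against finiteness of the support.\<close>

lemma homogeneous_eq_0_if_no_square_kernel: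
  fixes A :: "'g::linordered_ab_group_add \<Rightarrow> ('f::field^'n::finite^'n) set"
  assumes A: "is_grading A" and x: "x \<in> A g" and g: "g \<noteq> 0"
    and ker: "\<And>v. x *v v \<noteq> 0 \<Longrightarrow> x *v (x *v v) \<noteq> 0"
  shows "x = 0"
proof (rule ccontr)
  assume "x \<noteq> 0"
  then obtain v where v: "x *v v \<noteq> 0" by (metis matrix_eq matrix_vector_mult_0)
  \<comment> \<open>\<open>y k\<close> is the power of \<open>x\<close> with exponent
    \<open>k + 1\<close>, and \<open>h k\<close> is \<open>k + 1\<close> times
    \<open>g\<close>.\<close>
  define y where "y k = ((**) x ^^ k) x" for k
  define h where "h k = ((+) g ^^ k) g" for k
  have y: "y k \<in> A (h k)" for k
    by (induction k) (auto simp: y_def h_def x intro: gradingD(4)[OF A])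
  have "x *v (y k *v v) \<noteq> 0 \<and> y k *v v \<noteq> 0" for k
    by (induction k) (use v ker in \<open>auto simp: y_def matrix_vector_mul_assoc[symmetric]\<close>)
  then have "y k \<noteq> 0" for k by (metis matrix_vector_mult_0)
  then have "range h \<subseteq> {g. A g \<noteq> {0}}" using y by auto
  then have "finite (range h)" using grading_finite_support[OF A] finite_subset by blast
  moreover have "inj h"
  proof (cases "0 < g")
    case True
    then have "strict_mono h" by (intro strict_monoI_Suc) (simp add: h_def)
    then show ?thesis by (rule strict_mono_imp_inj_on)
  next
    case False
    then have "g < 0" using g by simp
    then have "strict_mono (\<lambda>k. - h k)" by (intro strict_monoI_Suc) (simp add: h_def)
    then have "inj (\<lambda>k. - h k)" by (rule strict_mono_imp_inj_on)
    then show ?thesis by (auto simp: inj_def)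
  qed
  ultimately show False by (metis finite_imageD infinite_UNIV_nat)
qed

text \<open>Choose a nonzero homogeneous element whose kernel has the largest dimension: any nonzero
  homogeneous element whose kernel contains this one has the same kernel.\<close>

lemma minimal_homogeneous_exists:
  fixes A :: "'g::comm_monoid_add \<Rightarrow> ('f::field^'n::finite^'n) set"
  assumes A: "is_grading A"
  obtains x g where "x \<in> A g" "x \<noteq> 0"
    "\<And>y h v. y \<in> A h \<Longrightarrow> y \<noteq> 0 \<Longrightarrow> (\<And>v. x *v v = 0 \<Longrightarrow> y *v v = 0) \<Longrightarrow> y *v v = 0 \<Longrightarrow> x *v v = 0"
proof -
  let ?K = "\<lambda>x :: 'f^'n^'n. {v. x *v v = 0}"
  have K: "vec.subspace (?K x)" for x :: "'f^'n^'n"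
    by (auto simp: vec.subspace_def matrix_vector_right_distrib vector_scalar_commute)
  let ?P = "\<lambda>x. x \<noteq> 0 \<and> (\<exists>g. x \<in> A g)"
  obtain c where c: "finite {g. c g \<noteq> 0}" "\<And>g. c g \<in> A g" "(mat 1 :: 'f^'n^'n) = sum c {g. c g \<noteq> 0}"
    by (rule grading_decompose[OF A, of "mat 1"]) blast
  have "\<exists>g. c g \<noteq> 0"
  proof (rule ccontr)
    assume "\<not> (\<exists>g. c g \<noteq> 0)"
    then have "(mat 1 :: 'f^'n^'n) = 0" using c(3) by simp
    then have "(mat 1 :: 'f^'n^'n) $ i $ i = 0" for i by simp
    then show False by (simp add: mat_def)
  qed
  then have ex: "\<exists>x. ?P x" using c(2) by blast
  have bd: "vec.dim (?K x) < Suc CARD('n)" for x :: "'f^'n^'n"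
    using vec.dim_subset[of "?K x" UNIV] by (simp only: vec_dim_card less_Suc_eq_le subset_UNIV)
  obtain x where x: "?P x" and max: "\<And>y. ?P y \<Longrightarrow> vec.dim (?K y) \<le> vec.dim (?K x)"
    using ex bd ex_has_greatest_nat[of ?P _ "\<lambda>x. vec.dim (?K x)" "Suc CARD('n)"] by metis
  have "x *v v = 0" if y: "y \<in> A h" "y \<noteq> 0" "\<And>v. x *v v = 0 \<Longrightarrow> y *v v = 0" "y *v v = 0" for y h v
  proof -
    have "?K x \<subseteq> ?K y" using y(3) by blast
    moreover have "vec.dim (?K y) \<le> vec.dim (?K x)" using max y by blast
    ultimately have "?K x = ?K y" by (intro vec.subspace_dim_equal K)
    then show ?thesis using y(4) by blast
  qed
  then show ?thesis using that x by blast
qed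

text \<open>A nonzero homogeneous element with maximal kernel plays the role of a generator of a minimal
  graded left ideal; \<open>e\<close> is the primitive idempotent that it yields.\<close>

lemma homogeneous_primitive_idempotent_exists:
  fixes A :: "'g::linordered_ab_group_add \<Rightarrow> ('f::field^'n::finite^'n) set"
  assumes ac: "alg_closed TYPE('f)" and A: "is_grading A"
  obtains e where "e \<in> A 0" "e \<noteq> 0" "e ** e = e" "\<And>M. \<exists>c. e ** M ** e = msmult c e"
proof -
  obtain x g where x: "x \<in> A g" "x \<noteq> 0"
    and min: "\<And>y h v. y \<in> A h \<Longrightarrow> y \<noteq> 0 \<Longrightarrow> (\<And>v. x *v v = 0 \<Longrightarrow> y *v v = 0) \<Longrightarrow> y *v v = 0 \<Longrightarrow> x *v v = 0"
    by (rule minimal_homogeneous_exists[OF A]) blast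
  have range_sub: "vec.subspace (range ((*v) z))" for z :: "'f^'n^'n"
    by (intro vec.subspace_UNIV vec.linear_subspace_image matrix_vector_mul_linear_gen)
  obtain i j where ij: "x $ i $ j \<noteq> 0" using x(2) by (auto simp: vec_eq_iff)
  \<comment> \<open>A matrix unit opposite to a nonzero entry of \<open>x\<close>, so that
    \<open>x ** E ** x\<close> is nonzero; some homogeneous component of \<open>E\<close> inherits
    this.\<close>
  define E :: "'f^'n^'n" where "E = (\<chi> k l. if k = j \<and> l = i then 1 else 0)"
  have "(x ** E ** x) $ i $ j = x $ i $ j * x $ i $ j"
  proof -
    have "(x ** E) $ i $ l = (if l = i then x $ i $ j else 0)" for l
    proof -
      have "(x ** E) $ i $ l = (\<Sum>k\<in>UNIV. if k = j then (if l = i then x $ i $ j else 0) else 0)"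
        unfolding matrix_matrix_mult_def vec_lambda_beta by (intro sum.cong) (auto simp: E_def)
      then show ?thesis by simp
    qed
    then have "(x ** E ** x) $ i $ j = (\<Sum>l\<in>UNIV. if l = i then x $ i $ j * x $ i $ j else 0)"
      unfolding matrix_matrix_mult_def[of "x ** E" x] vec_lambda_beta by (intro sum.cong) auto
    then show ?thesis by simp
  qed
  then have "x ** E ** x \<noteq> 0" using ij by auto
  obtain c where c: "finite {g. c g \<noteq> 0}" "\<And>g. c g \<in> A g" "E = sum c {g. c g \<noteq> 0}"
    by (rule grading_decompose[OF A, of E]) blast
  have "\<exists>h. x ** c h ** x \<noteq> 0"
  proof (rule ccontr)
    assume "\<not> ?thesis"
    then have "x ** E ** x = 0" unfolding c(3) matrix_mult_sum_left matrix_mult_sum_right by simp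
    then show False using \<open>x ** E ** x \<noteq> 0\<close> by simp
  qed
  then obtain h where h: "x ** c h ** x \<noteq> 0" ..
  define z where "z = c h ** x"
  have z: "z \<in> A (h + g)" unfolding z_def by (intro gradingD(4)[OF A] c x)
  have "z \<noteq> 0" using h by (auto simp: z_def matrix_mul_assoc[symmetric])
  have kz: "z *v v = 0 \<longleftrightarrow> x *v v = 0" for v
  proof
    have x0: "z *v v = 0" if "x *v v = 0" for v
      using that by (simp add: z_def matrix_vector_mul_assoc[symmetric])
    then show "x *v v = 0 \<Longrightarrow> z *v v = 0" .
    show "z *v v = 0 \<Longrightarrow> x *v v = 0" by (rule min[OF z \<open>z \<noteq> 0\<close> x0])
  qed
  \<comment> \<open>Otherwise \<open>z\<close> maps into its own kernel, which is the kernel of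
    \<open>x\<close>, and \<open>x ** z\<close> would vanish.\<close>
  have "z ** z \<noteq> 0"
  proof
    assume "z ** z = 0"
    then have "x *v (z *v v) = 0" for v
      unfolding kz[symmetric] by (simp add: matrix_vector_mul_assoc)
    then have "x ** z = 0" by (simp add: matrix_eq matrix_vector_mul_assoc)
    then show False using h by (simp add: z_def matrix_mul_assoc)
  qed
  have zz: "z *v (z *v v) \<noteq> 0" if "z *v v \<noteq> 0" for v
  proof
    assume "z *v (z *v v) = 0"
    have "x *v v = 0"
    proof (rule min[OF gradingD(4)[OF A z z] \<open>z ** z \<noteq> 0\<close>])
      show "(z ** z) *v v = 0" using \<open>z *v (z *v v) = 0\<close> by (simp only: matrix_vector_mul_assoc)
      fix v assume "x *v v = 0"
      then have "z *v v = 0" by (simp only: kz)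
      then show "(z ** z) *v v = 0" by (simp add: matrix_vector_mul_assoc[symmetric])
    qed
    then show False using that kz by blast
  qed
  have "h + g = 0" using homogeneous_eq_0_if_no_square_kernel[OF A z] zz \<open>z \<noteq> 0\<close> by blast
  with z have z0: "z \<in> A 0" by simp
  obtain w where "z *v w \<noteq> 0" using \<open>z \<noteq> 0\<close> by (metis matrix_eq matrix_vector_mult_0)
  then obtain v0 c0 where "v0 \<in> range ((*v) z)" "v0 \<noteq> 0" "z *v v0 = c0 *s v0"
    using eigenvector_in_invariant_subspace[OF ac range_sub, of z z "z *v w"] by blast
  then obtain v1 where v1: "z *v v1 \<noteq> 0" "z *v (z *v v1) = c0 *s (z *v v1)" by blast
  \<comment> \<open>The difference has degree 0 because \<open>z\<close> has; it kills the kernel of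
    \<open>x\<close> and also \<open>v1\<close> outside that kernel. By maximality it is 0, and
    rescaling \<open>z\<close> gives an idempotent.\<close>
  have zz_eq: "z ** z = msmult c0 z"
  proof (rule ccontr)
    let ?y = "z ** z - msmult c0 z"
    assume "z ** z \<noteq> msmult c0 z"
    then have "?y \<noteq> 0" by simp
    moreover have "?y \<in> A 0" using gradingD(4)[OF A z0 z0] gradingD(3)[OF A z0] by (intro grading_diff[OF A]) auto
    moreover have y: "?y *v v = z *v (z *v v) - c0 *s (z *v v)" for v
      by (simp add: matrix_vector_mult_diff_rdistrib matrix_vector_mul_assoc msmult_vector)
    ultimately have "x *v v1 = 0"
    proof (intro min[of ?y 0])
      fix u assume "x *v u = 0"
      then have "z *v u = 0" by (simp only: kz)
      then show "?y *v u = 0" unfolding y by simp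
    next
      show "?y *v v1 = 0" unfolding y v1(2) by simp
    qed
    then show False using kz v1(1) by blast
  qed
  have "c0 \<noteq> 0" using zz_eq \<open>z ** z \<noteq> 0\<close> by auto
  define e where "e = msmult (1 / c0) z"
  have e0: "e \<in> A 0" unfolding e_def by (rule gradingD(3)[OF A z0])
  have ee: "e ** e = e"
    unfolding e_def msmult_mult[symmetric] zz_eq msmult_msmult using \<open>c0 \<noteq> 0\<close> by simp
  have ke: "e *v v = 0 \<longleftrightarrow> x *v v = 0" for v
    using \<open>c0 \<noteq> 0\<close> kz by (simp add: e_def msmult_vector vec.scale_eq_0_iff)
  have "e \<noteq> 0" using ke x(2) by (metis matrix_eq matrix_vector_mult_0)
  have eev: "e *v (e *v v) = e *v v" for v by (simp add: matrix_vector_mul_assoc ee)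
  \<comment> \<open>The reasoning for \<open>z\<close>, repeated for \<open>e ** y ** e\<close>: if
    nonzero it has the kernel of \<open>e\<close>, hence degree 0, and an eigenvector in the range
    of \<open>e\<close> identifies it as a multiple of \<open>e\<close>.\<close>
  have hom: "\<exists>c. e ** y ** e = msmult c e" if y: "y \<in> A h" for y h
  proof (cases "e ** y ** e = 0")
    case True
    then show ?thesis by (metis msmult_zero)
  next
    case False
    define t where "t = e ** y ** e"
    have t: "t \<in> A h" using gradingD(4)[OF A gradingD(4)[OF A e0 y] e0] by (simp add: t_def)
    have tv: "t *v v = e *v (y *v (e *v v))" for v by (simp add: t_def matrix_vector_mul_assoc matrix_mul_assoc)
    have kt: "t *v v = 0 \<longleftrightarrow> e *v v = 0" for v
    proof
      have et: "t *v v = 0" if "e *v v = 0" for v using that by (simp add: tv)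
      then show "e *v v = 0 \<Longrightarrow> t *v v = 0" .
      assume "t *v v = 0"
      then have "x *v v = 0"
      proof (rule min[OF t, rotated 2])
        show "t \<noteq> 0" using False by (simp add: t_def)
        fix u assume "x *v u = 0"
        then have "e *v u = 0" by (simp only: ke)
        then show "t *v u = 0" by (rule et)
      qed
      then show "e *v v = 0" by (simp only: ke)
    qed
    have tt: "t *v (t *v v) \<noteq> 0" if "t *v v \<noteq> 0" for v
    proof -
      have "e *v (t *v v) = t *v v" by (simp add: tv eev)
      then have "e *v (t *v v) \<noteq> 0" using that by (simp only: not_False_eq_True)
      then show ?thesis by (simp only: kt not_False_eq_True)
    qed
    have "h = 0"
    proof (rule ccontr)
      assume "h \<noteq> 0"
      then have "t = 0" by (rule homogeneous_eq_0_if_no_square_kernel[OF A t _ tt])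
      then show False using False by (simp add: t_def)
    qed
    obtain w where "e *v w \<noteq> 0" using \<open>e \<noteq> 0\<close> by (metis matrix_eq matrix_vector_mult_0)
    moreover have range_t: "t *v v \<in> range ((*v) e)" for v by (simp add: tv)
    ultimately obtain v c where v: "v \<in> range ((*v) e)" "v \<noteq> 0" "t *v v = c *s v"
      using eigenvector_in_invariant_subspace[OF ac range_sub, of e t "e *v w"] range_t by blast
    then have ev: "e *v v = v" using eev by auto
    have "t = msmult c e"
    proof (rule ccontr)
      let ?y = "t - msmult c e"
      assume "t \<noteq> msmult c e"
      then have "?y \<noteq> 0" by simp
      moreover have "?y \<in> A 0" using t \<open>h = 0\<close> gradingD(3)[OF A e0] by (intro grading_diff[OF A]) auto
      moreover have y: "?y *v v = t *v v - c *s (e *v v)" for v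
        by (simp add: matrix_vector_mult_diff_rdistrib msmult_vector)
      ultimately have "x *v v = 0"
      proof (intro min[of ?y 0])
        fix u assume "x *v u = 0"
        then have "e *v u = 0" "t *v u = 0" by (simp_all only: ke kt)
        then show "?y *v u = 0" unfolding y by simp
      next
        show "?y *v v = 0" unfolding y v(3) ev by simp
      qed
      then have "e *v v = 0" by (simp only: ke)
      then show False using ev v(2) by simp
    qed
    then show ?thesis by (auto simp: t_def)
  qed
  have "\<exists>c. e ** M ** e = msmult c e" for M
  proof -
    obtain c where c: "finite {g. c g \<noteq> 0}" "\<And>g. c g \<in> A g" "M = sum c {g. c g \<noteq> 0}"
      by (rule grading_decompose[OF A, of M]) blast
    have "\<forall>g. \<exists>m. e ** c g ** e = msmult m e" using hom c(2) by blast
    then obtain m where "\<And>g. e ** c g ** e = msmult (m g) e" by metis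
    then have "e ** M ** e = msmult (\<Sum>g | c g \<noteq> 0. m g) e"
      unfolding c(3) matrix_mult_sum_left matrix_mult_sum_right msmult_sum_left by simp
    then show ?thesis ..
  qed
  then show ?thesis using that e0 \<open>e \<noteq> 0\<close> ee by blast
qed

section \<open>Passage to a homogeneous basis of the column space\<close>

lemma alg_iso_conjugation:
  fixes P P' :: "'f::field^'n::finite^'n"
  assumes "P' ** P = mat 1"
  shows "alg_iso (\<lambda>M. P' ** M ** P)"
proof -
  have P: "P ** P' = mat 1" using assms by (simp add: matrix_left_right_inverse)
  have c: "P ** (P' ** M) = M" "P' ** (P ** M) = M" for M
    by (simp_all add: matrix_mul_assoc assms P)
  have "bij (\<lambda>M. P' ** M ** P)"
  proof (rule o_bij[of "\<lambda>M. P ** M ** P'"])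
    show "(\<lambda>M. P ** M ** P') \<circ> (\<lambda>M. P' ** M ** P) = id" "(\<lambda>M. P' ** M ** P) \<circ> (\<lambda>M. P ** M ** P') = id"
      by (auto simp: fun_eq_iff matrix_mul_assoc[symmetric] c assms P)
  qed
  moreover have "P' ** msmult a M ** P = msmult a (P' ** M ** P)" for a M
  proof -
    have "msmult a (P' ** M ** P) = msmult (1 * a * 1) (P' ** M ** P)" by simp
    also have "\<dots> = msmult 1 P' ** msmult a M ** msmult 1 P" by (simp only: msmult_mult)
    finally show ?thesis by simp
  qed
  moreover have "(X + Y) ** Z = X ** Z + Y ** Z" for X Y Z :: "'f^'n^'n"
    by (simp add: vec_eq_iff matrix_matrix_mult_def distrib_right sum.distrib)
  ultimately show ?thesis unfolding alg_iso_def
    by (simp add: matrix_add_ldistrib matrix_mul_assoc[symmetric] c)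
qed

lemma exists_matrix_vector_mult_eq:
  fixes u v :: "'f::field^'n::finite"
  assumes "u \<noteq> 0"
  shows "\<exists>N. N *v u = v"
proof -
  obtain i where i: "u $ i \<noteq> 0" using assms by (auto simp: vec_eq_iff)
  define N :: "'f^'n^'n" where "N = (\<chi> k l. if l = i then v $ k / u $ i else 0)"
  have "(\<Sum>l\<in>UNIV. N $ k $ l * u $ l) = v $ k" for k
  proof -
    have "(\<Sum>l\<in>UNIV. N $ k $ l * u $ l) = (\<Sum>l\<in>{i}. N $ k $ l * u $ l)"
      by (rule sum.mono_neutral_right) (auto simp: N_def)
    then show ?thesis using i by (simp add: N_def)
  qed
  then have "N *v u = v" by (simp add: vec_eq_iff matrix_vector_mult_def)
  then show ?thesis ..
qed

text \<open>Every vector is \<open>N *v u\<close> for some matrix \<open>N\<close>; decomposing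
  \<open>N\<close> shows that the images of \<open>u\<close> under homogeneous matrices span, so a
  basis can be chosen among them. It forms the columns of \<open>P\<close>.\<close>

lemma homogeneous_basis_exists:
  fixes A :: "'g::comm_monoid_add \<Rightarrow> ('f::field^'n::finite^'n) set"
  assumes A: "is_grading A" and u: "u \<noteq> 0"
  obtains P' P :: "'f^'n^'n" and m \<delta> where "P' ** P = mat 1"
    "\<And>i. m i \<in> A (\<delta> i)" "\<And>i. column i P = m i *v u"
proof -
  define H where "H = {v. \<exists>g M. M \<in> A g \<and> v = M *v u}"
  have "v \<in> vec.span H" for v
  proof -
    obtain N where N: "N *v u = v" using exists_matrix_vector_mult_eq[OF u] by blast
    obtain c where c: "finite {g. c g \<noteq> 0}" "\<And>g. c g \<in> A g" "N = sum c {g. c g \<noteq> 0}"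
      by (rule grading_decompose[OF A, of N]) blast
    have "v = (\<Sum>g | c g \<noteq> 0. c g *v u)"
      unfolding N[symmetric] by (subst c(3)) (rule matrix_vector_mult_sum)
    moreover have "c g *v u \<in> vec.span H" for g
      using c(2) by (intro vec.span_base) (auto simp: H_def)
    ultimately show ?thesis by (metis (no_types, lifting) vec.span_sum)
  qed
  then have span: "vec.span H = UNIV" by blast
  obtain B where B: "B \<subseteq> H" "vec.independent B" "H \<subseteq> vec.span B" "card B = vec.dim H"
    by (rule vec.basis_exists[of H]) blast
  have fin: "finite B" using B(2) by (rule vec.finiteI_independent)
  have "vec.dim H = vec.dim (UNIV :: ('f^'n) set)" using span by (metis vec.dim_span)
  then have "card B = CARD('n)" using B(4) by (simp only: vec_dim_card)
  then obtain f :: "'n \<Rightarrow> 'f^'n" where f: "bij_betw f UNIV B"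
    using finite_same_card_bij[OF finite_class.finite_UNIV fin] by metis
  have "\<forall>i. \<exists>m g. m \<in> A g \<and> f i = m *v u" 
  proof
    fix i
    have "f i \<in> H" using f B(1) by (auto simp: bij_betw_def)
    then show "\<exists>m g. m \<in> A g \<and> f i = m *v u" unfolding H_def by blast
  qed
  then obtain m \<delta> where m: "\<And>i. m i \<in> A (\<delta> i)" "\<And>i. f i = m i *v u" by metis
  define P :: "'f^'n^'n" where "P = (\<chi> k l. f l $ k)"
  have col: "column i P = f i" for i by (simp add: column_def P_def)
  have "\<exists>P'. P' ** P = mat 1"
    unfolding matrix_left_invertible_independent_columns col
  proof (intro allI impI)
    fix c i assume z: "(\<Sum>i\<in>UNIV. c i *s f i) = 0"
    define d where "d v = c (inv_into UNIV f v)" for v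
    have inj: "inj f" using f by (simp add: bij_betw_def)
    have "(\<Sum>v\<in>B. d v *s v) = (\<Sum>i\<in>UNIV. d (f i) *s f i)"
      by (rule sum.reindex_bij_betw[OF f, symmetric])
    then have "(\<Sum>v\<in>B. d v *s v) = 0" using z by (simp add: d_def inj)
    then have "d (f i) = 0"
      using B(2) fin f by (auto simp: vec.dependent_finite bij_betw_def)
    then show "c i = 0" by (simp add: d_def inj)
  qed
  then show ?thesis using that m col by metis
qed

text \<open>\<open>\<phi> M\<close> is the matrix of \<open>M\<close> in the basis
  \<open>m i *v u\<close>. No grading of the column space is constructed: \<open>ann\<close> lifts a
  relation between vectors \<open>M *v u\<close> to the matrices \<open>M ** e\<close>, where the
  directness of \<open>A\<close> applies.\<close>

lemma grading_iso_elementary: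
  fixes A :: "'g::linordered_ab_group_add \<Rightarrow> ('f::field^'n::finite^'n) set"
  assumes ac: "alg_closed TYPE('f)" and A: "is_grading A"
  shows "\<exists>d. iso_gradings A (elementary_grading d)"
proof -
  obtain e where e: "e \<in> A 0" "e \<noteq> 0" "e ** e = e" and prim: "\<And>M. \<exists>c. e ** M ** e = msmult c e"
    by (rule homogeneous_primitive_idempotent_exists[OF ac A]) blast
  obtain w where "e *v w \<noteq> 0" using e(2) by (metis matrix_eq matrix_vector_mult_0)
  define u where "u = e *v w"
  have u: "u \<noteq> 0" "e *v u = u" using \<open>e *v w \<noteq> 0\<close> by (simp_all add: u_def matrix_vector_mul_assoc e(3))
  obtain P' P :: "'f^'n^'n" and m \<delta> where P: "P' ** P = mat 1"
    and m: "\<And>i. m i \<in> A (\<delta> i)" and col: "\<And>i. column i P = m i *v u"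
    by (rule homogeneous_basis_exists[OF A u(1)]) blast
  have PP': "P ** P' = mat 1" using P by (simp add: matrix_left_right_inverse)
  \<comment> \<open>Primitivity makes the range of \<open>e\<close> the line through
    \<open>u\<close>: writing \<open>a = N *v u\<close>, the vector \<open>e *v a\<close> equals
    \<open>(e ** N ** e) *v u\<close>, a multiple of \<open>u\<close>.\<close>
  have ann: "M ** e = 0" if M: "M *v u = 0" for M
  proof -
    have "M *v (e *v a) = 0" for a
    proof -
      obtain N where a: "N *v u = a" using exists_matrix_vector_mult_eq[OF u(1)] by blast
      obtain c where c: "e ** N ** e = msmult c e" using prim by blast
      have "e *v a = e *v (N *v (e *v u))" by (simp only: a u(2))
      also have "\<dots> = (e ** N ** e) *v u" by (simp add: matrix_vector_mul_assoc matrix_mul_assoc)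
      also have "\<dots> = c *s u" by (simp add: c msmult_vector u(2))
      finally show ?thesis by (simp add: vector_scalar_commute M)
    qed
    then have "(M ** e) *v a = 0" for a by (simp add: matrix_vector_mul_assoc)
    then show ?thesis by (simp add: matrix_eq)
  qed
  have indep: "c i = 0" if "(\<Sum>i\<in>UNIV. c i *s (m i *v u)) = 0" for c i
    using matrix_left_invertible_independent_columns[of P] P that unfolding col by blast
  define \<phi> where "\<phi> M = P' ** M ** P" for M
  \<comment> \<open>A matrix of degree \<open>g\<close> sends basis vector \<open>j\<close> to
    degree \<open>g + \<delta> j\<close>, so an entry (k, j) needs
    \<open>\<delta> k = g + \<delta> j\<close>; the convention \<open>d j - d k = g\<close> forces
    the minus sign.\<close>
  define d where "d i = - \<delta> i" for i
  have iso: "alg_iso \<phi>" unfolding \<phi>_def by (rule alg_iso_conjugation[OF P])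
  have sub: "\<phi> M \<in> elementary_grading d g" if M: "M \<in> A g" for M g
  proof -
    have "\<delta> k = g + \<delta> j" if kj: "\<phi> M $ k $ j \<noteq> 0" for k j
    proof (rule ccontr)
      assume ne: "\<delta> k \<noteq> g + \<delta> j"
      define N where "N = \<phi> M"
      have MP: "M ** P = P ** N" by (simp add: N_def \<phi>_def matrix_mul_assoc PP')
      have "M *v column j P = (\<Sum>i\<in>UNIV. N $ i $ j *s column i P)"
      proof -
        have "(M *v column j P) $ l = (M ** P) $ l $ j" for l
          by (simp add: matrix_vector_mult_def matrix_matrix_mult_def column_def)
        moreover have "(P ** N) $ l $ j = (\<Sum>i\<in>UNIV. N $ i $ j *s column i P) $ l" for l
          by (simp add: matrix_matrix_mult_def column_def mult.commute)
        ultimately show ?thesis by (simp add: vec_eq_iff MP)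
      qed
      then have "(M ** m j - (\<Sum>i\<in>UNIV. msmult (N $ i $ j) (m i))) *v u = 0"
        by (simp add: col matrix_vector_mult_diff_rdistrib matrix_vector_mult_sum msmult_vector matrix_vector_mul_assoc)
      from ann[OF this]
      have r0: "M ** m j ** e - (\<Sum>i\<in>UNIV. msmult (N $ i $ j) (m i ** e)) = 0"
      proof -
        have "(X - Y) ** e = X ** e - Y ** e" for X Y :: "'f^'n^'n"
          by (simp add: vec_eq_iff matrix_matrix_mult_def left_diff_distrib sum_subtractf)
        moreover have "msmult a X ** e = msmult a (X ** e)" for a and X :: "'f^'n^'n"
          using msmult_mult[of a 1 X e] by simp
        ultimately show ?thesis using \<open>_ ** e = 0\<close> by (simp add: matrix_mult_sum_left)
      qed
      have me: "m i ** e \<in> A (\<delta> i)" for i using gradingD(4)[OF A m e(1), of i] by simp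
      \<comment> \<open>The component of degree \<open>h\<close> in the relation
        \<open>r0\<close>.\<close>
      define c where "c h = (if h = g + \<delta> j then M ** m j ** e else 0)
        - (\<Sum>i | \<delta> i = h. msmult (N $ i $ j) (m i ** e))" for h
      define T where "T = insert (g + \<delta> j) (range \<delta>)"
      have finT: "finite T" by (simp add: T_def)
      have cA: "c h \<in> A h" for h
      proof -
        have "M ** m j ** e \<in> A (g + \<delta> j)"
          using gradingD(4)[OF A gradingD(4)[OF A M m] e(1), of j] by simp
        then have "(if h = g + \<delta> j then M ** m j ** e else 0) \<in> A h"
          using gradingD(1)[OF A] by simp
        then show ?thesis unfolding c_def
          by (intro grading_diff[OF A] grading_sum[OF A] gradingD(3)[OF A]) (use me in auto)
      qed
      have "(\<Sum>h\<in>T. \<Sum>i | \<delta> i = h. msmult (N $ i $ j) (m i ** e)) = (\<Sum>i\<in>UNIV. msmult (N $ i $ j) (m i ** e))"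
        using sum.group[of UNIV T \<delta> "\<lambda>i. msmult (N $ i $ j) (m i ** e)"] finT
        by (auto simp: T_def)
      moreover have "(\<Sum>h\<in>T. if h = g + \<delta> j then M ** m j ** e else 0) = M ** m j ** e"
        using finT by (simp add: T_def)
      ultimately have "sum c T = 0" using r0 by (simp add: c_def sum_subtractf)
      then have "c (\<delta> k) = 0" using grading_independent[OF A finT cA] by (simp add: T_def)
      \<comment> \<open>Since \<open>\<delta> k\<close> differs from \<open>g + \<delta> j\<close>,
        only basis terms occur in this degree. Applied to \<open>u\<close> they give a linear
        relation, which kills the coefficient at \<open>k\<close>.\<close>
      then have "(\<Sum>i | \<delta> i = \<delta> k. msmult (N $ i $ j) (m i ** e)) = 0" using ne by (simp add: c_def)
      then have "(\<Sum>i | \<delta> i = \<delta> k. msmult (N $ i $ j) (m i ** e)) *v u = 0" by simp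
      then have "(\<Sum>i | \<delta> i = \<delta> k. N $ i $ j *s (m i *v u)) = 0"
        by (simp add: matrix_vector_mult_sum msmult_vector matrix_vector_mul_assoc[symmetric] u(2))
      moreover have "(\<Sum>i | \<delta> i = \<delta> k. N $ i $ j *s (m i *v u))
          = (\<Sum>i\<in>UNIV. (if \<delta> i = \<delta> k then N $ i $ j else 0) *s (m i *v u))"
        by (intro sum.mono_neutral_cong_left) auto
      ultimately have "(if \<delta> k = \<delta> k then N $ k $ j else 0) = 0"
        by (intro indep) simp
      then show False using kj by (simp add: N_def)
    qed
    then show ?thesis by (auto simp: elementary_grading_def d_def)
  qed
  have "\<phi> ` A g = elementary_grading d g" for g
  proof
    show "\<phi> ` A g \<subseteq> elementary_grading d g" using sub by blast
    show "elementary_grading d g \<subseteq> \<phi> ` A g"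
    proof
      fix N :: "'f^'n^'n" assume N: "N \<in> elementary_grading d g"
      obtain M where M: "N = \<phi> M" using iso unfolding alg_iso_def by (metis bij_pointE)
      obtain c where c: "finite {g. c g \<noteq> 0}" "\<And>g. c g \<in> A g" "M = sum c {g. c g \<noteq> 0}"
        by (rule grading_decompose[OF A, of M]) blast
      have Nsum: "N = (\<Sum>h | c h \<noteq> 0. \<phi> (c h))"
        unfolding M by (subst c(3)) (rule alg_iso_sum[OF iso])
      \<comment> \<open>A nonzero entry of \<open>\<phi> (c h)\<close> sits at a position of degree
        \<open>h\<close>, where no other component contributes; it survives in \<open>N\<close>,
        whose nonzero entries have degree \<open>g\<close>.\<close>
      have "c h = 0" if h: "h \<noteq> g" for h
      proof (rule ccontr)
        assume ch: "c h \<noteq> 0"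
        have "\<phi> (c h) \<noteq> \<phi> 0" using ch iso by (auto simp: alg_iso_def bij_def dest: injD)
        then have "\<phi> (c h) \<noteq> 0" by (simp add: alg_iso_zero[OF iso])
        then obtain p q where pq: "\<phi> (c h) $ p $ q \<noteq> 0" by (auto simp: vec_eq_iff)
        then have dh: "d q - d p = h" using sub[OF c(2)] by (auto simp: elementary_grading_def)
        have "\<phi> (c h') $ p $ q = 0" if "h' \<noteq> h" for h'
          using sub[OF c(2), of h'] dh that by (auto simp: elementary_grading_def)
        then have "(\<Sum>h' | c h' \<noteq> 0. \<phi> (c h') $ p $ q) = (\<Sum>h'\<in>{h}. \<phi> (c h') $ p $ q)"
          using c(1) ch by (intro sum.mono_neutral_right) auto
        then have "N $ p $ q = \<phi> (c h) $ p $ q" by (simp add: Nsum)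
        then have "d q - d p = g" using N pq by (auto simp: elementary_grading_def)
        then show False using dh h by simp
      qed
      then have "sum c {g. c g \<noteq> 0} = sum c {g}" by (intro sum.mono_neutral_left) auto
      then have "M = c g" using c(3) by simp
      then show "N \<in> \<phi> ` A g" using c(2) M by blast
    qed
  qed
  then show ?thesis using iso unfolding iso_gradings_def by blast
qed

theorem mainTheorem11:
  fixes A :: "'g::linordered_ab_group_add \<Rightarrow> ('f::field_char_0^4^4) set"
  assumes "alg_closed TYPE('f)"
    and "is_grading A"
    and "\<forall>x\<in>A 0. \<forall>y\<in>A 0. x ** y = y ** x"
  shows "graded_identities A = TG_generated (gen_identities A) \<longleftrightarrow>
    (\<exists>a b::'g. 0 < a \<and> 0 < b \<and> a \<noteq> b + b \<and> a + a \<noteq> b \<and>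
       iso_gradings A (elementary_grading
          (\<lambda>i::4. if i = 0 then 0 else if i = 1 then a else if i = 2 then a + b else a + a + b)))"
  unfolding gap_tuple_symmetric[symmetric]
proof
  assume gen: "graded_identities A = TG_generated (gen_identities A)"
  obtain d where d: "iso_gradings A (elementary_grading d)"
    using grading_iso_elementary[OF assms(1,2)] by blast
  then obtain \<phi> where \<phi>: "alg_iso \<phi>" "\<And>g. \<phi> ` A g = elementary_grading d g"
    unfolding iso_gradings_def by blast
  \<comment> \<open>Commutativity of \<open>A 0\<close> is carried over by \<open>\<phi>\<close> to
    the elementary grading, where it rules out repeated degrees.\<close>
  have "inj d"
  proof (rule inj_if_neutral_component_commutative)
    fix x y :: "'f^4^4" assume "x \<in> elementary_grading d 0" "y \<in> elementary_grading d 0"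
    then obtain x' y' where "x' \<in> A 0" "y' \<in> A 0" "x = \<phi> x'" "y = \<phi> y'"
      unfolding \<phi>(2)[symmetric] by blast
    then show "x ** y = y ** x" using assms(3) \<phi>(1) unfolding alg_iso_def by metis
  qed
  then obtain x y z where pos: "0 < x" "0 < y" "0 < z"
    and "iso_gradings (elementary_grading d :: 'g \<Rightarrow> ('f^4^4) set) (elementary_grading (gap_tuple x y z))"
    by (rule elementary_grading_iso_gap_tuple)
  then have iso: "iso_gradings A (elementary_grading (gap_tuple x y z))"
    using iso_gradings_trans[OF d] by blast
  have "x = z \<and> x \<noteq> y + y \<and> x + x \<noteq> y"
    using gaps_if_generated[OF pos] gen graded_identities_iso[OF iso] gen_identities_iso[OF iso] by metis
  then show "\<exists>a b. 0 < a \<and> 0 < b \<and> a \<noteq> b + b \<and> a + a \<noteq> b \<and>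
      iso_gradings A (elementary_grading (gap_tuple a b a))"
    using pos iso by metis
next
  assume "\<exists>a b. 0 < a \<and> 0 < b \<and> a \<noteq> b + b \<and> a + a \<noteq> b \<and>
      iso_gradings A (elementary_grading (gap_tuple a b a))"
  then obtain a b where ab: "0 < a" "0 < b" "a \<noteq> b + b" "a + a \<noteq> b"
    and iso: "iso_gradings A (elementary_grading (gap_tuple a b a))" by blast
  show "graded_identities A = TG_generated (gen_identities A)"
    using symmetric_gaps_generated[OF ab] graded_identities_iso[OF iso] gen_identities_iso[OF iso] by metis
qed

end
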